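(* Let $k$ be a field and let $\Gamma$ be a finite graph with vertex set $V(\Gamma)$, set of oriented edges $\overset{\rightarrow}{E}(\Gamma)$, set of unoriented edges $E(\Gamma)$, and source and target maps $s,t:\overset{\rightarrow}{E}(\Gamma)\to V(\Gamma)$. Let $$T_\Gamma:=\prod_{v\in V(\Gamma)}\mathbb G_m \quad\text{and}\quad A(\Gamma):=\frac{k[U_{\overset{\leftarrow}{e}},U_{\overset{\rightarrow}{e}} : e\in E(\Gamma)]}{(U_{\overset{\leftarrow}{e}}U_{\overset{\rightarrow}{e}} : e\in E(\Gamma))},$$ and let $T_\Gamma$ act on $A(\Gamma)$ by $\lambda\cdot U_{\overset{\rightarrow}{e}}=\lambda_{s(\overset{\rightarrow}{e})}\,U_{\overset{\rightarrow}{e}}\,\lambda_{t(\overset{\rightarrow}{e})}^{-1}$ for every oriented edge $\overset{\rightarrow}{e}$. Then the invariant subring $A(\Gamma)^{T_\Gamma}$ is isomorphic to the cographic ring $R(\Gamma)$.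
   Context: Graphs. A finite graph $\Gamma$ consists of finite sets $V(\Gamma)$ (vertices) and $\overset{\rightarrow}{E}(\Gamma)$ (oriented edges), a fixed-point-free involution $\iota$ of $\overset{\rightarrow}{E}(\Gamma)$, and maps $s,t:\overset{\rightarrow}{E}(\Gamma)\to V(\Gamma)$ with $s(\vec e)=t(\iota(\vec e))$ (loops and multiple edges are allowed). $E(\Gamma):=\overset{\rightarrow}{E}(\Gamma)/\iota$ is the set of edges; the two orientations of an edge $e$ are denoted $\overset{\rightarrow}{e}$ and $\overset{\leftarrow}{e}$. Homology. $\overset{\rightarrow}{C}_1(\Gamma,A)$ is the $A$-module generated by $\overset{\rightarrow}{E}(\Gamma)$ with relations $\overset{\leftarrow}{e}=-\overset{\rightarrow}{e}$; $\partial(\overset{\rightarrow}{e})=t(\overset{\rightarrow}{e})-s(\overset{\rightarrow}{e})$; $H_1(\Gamma,A)=\ker\partial$. The bilinear form $(\cdot,\cdot)$ on $\overset{\rightarrow}{C}_1(\Gamma,\mathbb R)$ is determined by $(\overset{\rightarrow}{e},\overset{\rightarrow}{e})=1$, $(\overset{\rightarrow}{e},\overset{\leftarrow}{e})=-1$, and $(\overset{\rightarrow}{e},\overset{\rightarrow}{f})=0$ if $f\neq e$. Cographic fan. The cographic arrangement is the set of hyperplanes $\{v\in H_1(\Gamma,\mathbb R): (v,e)=0\}$, for those $e\in E(\Gamma)$ for which $(\cdot,e)$ is not identically zero on $H_1(\Gamma,\mathbb R)$. The cographic fan $\mathcal F_\Gamma^\perp$ is the complete fan in $H_1(\Gamma,\mathbb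 R)$ whose cones are the closures of the connected components of the complement of this arrangement, together with all their faces. Cographic ring. $R(\Gamma)=R_k(\Gamma)$ is the $k$-algebra with $k$-basis $\{X^c: c\in H_1(\Gamma,\mathbb Z)\}$ and multiplication $X^c\cdot X^{c'}=X^{c+c'}$ if $c,c'$ lie in a common cone of $\mathcal F_\Gamma^\perp$, and $X^c\cdot X^{c'}=0$ otherwise. Invariants. $T_\Gamma$ is regarded as an algebraic torus over $k$, and its $S$-points for a $k$-scheme $S$ are tuples $\lambda=(\lambda_v)_{v\in V(\Gamma)}$ with $\lambda_v\in\mathcal O_S^*$; invariants are invariants under this algebraic group action (i.e. the weight-zero part for the grading by characters of $T_\Gamma$). The isomorphism is one of $k$-algebras. *)

theory Defs
  imports
    "HOL-Analysis.Analysis"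
    "HOL-Algebra.QuotRing"
    "HOL-Library.Poly_Mapping"
    "Graph_Theory.Bidirected_Digraph"
begin

section \<open>Graphs\<close>

text \<open>
  The arcs are the oriented edges, \<^term>\<open>tail G\<close> and \<^term>\<open>head G\<close> are the maps $s$ and $t$, and
  \<open>arev\<close> is the involution. The locale \<^locale>\<open>bidirected_digraph\<close> makes \<open>arev\<close> a fixed-point-free
  involution of the arcs; outside the arcs it is, by convention, the identity. Loops, multiple
  edges and the empty graph are allowed.
\<close>

locale finite_graph = fin_digraph G + bidirected_digraph G arev
  for G :: "('v, 'e) pre_digraph" and arev :: "'e \<Rightarrow> 'e"


section \<open>Homology\<close>

text \<open>
  The module generated by the arcs subject to \<open>arev e = - e\<close> is realised inside the functions on
  arcs: the class of $\sum_e a_e e$ corresponds to the antisymmetric function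
  $e \mapsto a_e - a_{\iota(e)}$. The lemma \<open>edge_chains_universal\<close> below is the universal property of the
  presentation by generators and relations.
\<close>

definition edge_chains :: "('v, 'e) pre_digraph \<Rightarrow> ('e \<Rightarrow> 'e) \<Rightarrow> ('e \<Rightarrow> 'a::comm_ring_1) set" where
  "edge_chains G arev =
     {c. (\<forall>e\<in>arcs G. c (arev e) = - c e) \<and> (\<forall>e. e \<notin> arcs G \<longrightarrow> c e = 0)}"

definition arc_chain :: "('e \<Rightarrow> 'e) \<Rightarrow> 'e \<Rightarrow> 'e \<Rightarrow> 'a::comm_ring_1" where
  "arc_chain arev e = (\<lambda>f. of_bool (f = e) - of_bool (f = arev e))"

text \<open>
  Each edge contributes to the coefficient of \<open>v\<close> through those of its orientations that end in \<open>v\<close>;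
  see \<open>boundary_arc_chain\<close>.
\<close>

definition boundary :: "('v, 'e) pre_digraph \<Rightarrow> ('e \<Rightarrow> 'a::comm_ring_1) \<Rightarrow> 'v \<Rightarrow> 'a" where
  "boundary G c = (\<lambda>v. \<Sum>e | e \<in> arcs G \<and> head G e = v. c e)"

definition homology :: "('v, 'e) pre_digraph \<Rightarrow> ('e \<Rightarrow> 'e) \<Rightarrow> ('e \<Rightarrow> 'a::comm_ring_1) set" where
  "homology G arev = {c \<in> edge_chains G arev. boundary G c = (\<lambda>_. 0)}"

text \<open>The factor one half is there because the sum runs over both orientations of each edge.\<close>

definition chain_form :: "('v, 'e) pre_digraph \<Rightarrow> ('e \<Rightarrow> real) \<Rightarrow> ('e \<Rightarrow> real) \<Rightarrow> real" where
  "chain_form G c d = (\<Sum>e\<in>arcs G. c e * d e) / 2"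

context finite_graph
begin

lemma arc_chain_in_edge_chains: "e \<in> arcs G \<Longrightarrow> arc_chain arev e \<in> edge_chains G arev"
  by (auto simp: edge_chains_def arc_chain_def of_bool_def) (metis arev_arev)+

lemma arc_chain_arev: "arc_chain arev (arev e) = (\<lambda>f. - arc_chain arev e f)"
  by (simp add: arc_chain_def)

lemma boundary_arc_chain:
  assumes "e \<in> arcs G"
  shows "boundary G (arc_chain arev e) = (\<lambda>v. of_bool (v = head G e) - of_bool (v = tail G e))"
proof
  fix v
  have *: "(\<Sum>f | f \<in> arcs G \<and> head G f = v. of_bool (f = d)) = of_bool (v = head G d)"
    if "d \<in> arcs G" for d
    using that by (auto simp: of_bool_def sum.delta)
  have "head G (arev e) = tail G e"
    using assms tail_arev[of "arev e"] by simp
  with assms *[of e] *[of "arev e"]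
  show "boundary G (arc_chain arev e) v = of_bool (v = head G e) - of_bool (v = tail G e)"
    by (simp add: boundary_def arc_chain_def sum_subtractf)
qed

lemma chain_form_arc_chain:
  assumes "c \<in> edge_chains G arev" "e \<in> arcs G"
  shows "chain_form G c (arc_chain arev e) = c e"
proof -
  have *: "(\<Sum>f\<in>arcs G. c f * of_bool (f = d)) = c d" if "d \<in> arcs G" for d
    using that by (simp add: of_bool_def if_distrib sum.delta cong: if_cong)
  show ?thesis
    using assms *[of e] *[of "arev e"]
    by (simp add: chain_form_def arc_chain_def right_diff_distrib sum_subtractf edge_chains_def)
qed

lemma chain_form_arcs:
  assumes "e \<in> arcs G" "f \<in> arcs G"
  shows "chain_form G (arc_chain arev e) (arc_chain arev e) = 1"
    and "chain_form G (arc_chain arev e) (arc_chain arev (arev e)) = -1"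
    and "f \<noteq> e \<Longrightarrow> f \<noteq> arev e \<Longrightarrow> chain_form G (arc_chain arev e) (arc_chain arev f) = 0"
proof -
  note * = chain_form_arc_chain[OF arc_chain_in_edge_chains[OF assms(1)]]
  show "chain_form G (arc_chain arev e) (arc_chain arev e) = 1"
    and "chain_form G (arc_chain arev e) (arc_chain arev (arev e)) = -1"
    using assms(1) arev_neq[OF assms(1)] by (auto simp: *) (auto simp: arc_chain_def)
  show "chain_form G (arc_chain arev e) (arc_chain arev f) = 0" if "f \<noteq> e" "f \<noteq> arev e"
    using assms(2) that by (simp add: *) (simp add: arc_chain_def)
qed

lemma orientation_exists:
  "\<exists>P\<subseteq>arcs G. (\<forall>e\<in>arcs G. e \<in> P \<longleftrightarrow> arev e \<notin> P)"
proof -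
  define S where "S = (\<lambda>e. {e, arev e}) ` arcs G"
  define P where "P = (\<lambda>s. SOME e. e \<in> s) ` S"
  have pick: "(SOME e'. e' \<in> {e, arev e}) \<in> {e, arev e}" for e
    by (rule someI[of _ e]) simp
  have "e \<in> P \<longleftrightarrow> (SOME e'. e' \<in> {e, arev e}) = e" if "e \<in> arcs G" for e
  proof
    assume "e \<in> P"
    then obtain d where d: "d \<in> arcs G" "e = (SOME e'. e' \<in> {d, arev d})"
      by (auto simp: P_def S_def)
    then have "e \<in> {d, arev d}"
      using pick[of d] by simp
    then have "{d, arev d} = {e, arev e}"
      by auto
    with d show "(SOME e'. e' \<in> {e, arev e}) = e" by simp
  next
    assume "(SOME e'. e' \<in> {e, arev e}) = e"
    moreover have "(SOME e'. e' \<in> {e, arev e}) \<in> P"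
      unfolding P_def S_def using that by (intro imageI)
    ultimately show "e \<in> P" by simp
  qed
  note iff = this
  have "e \<in> P \<longleftrightarrow> arev e \<notin> P" if "e \<in> arcs G" for e
  proof -
    have "arev e \<in> P \<longleftrightarrow> (SOME e'. e' \<in> {e, arev e}) = arev e"
      using iff[of "arev e"] that by (simp add: insert_commute)
    then show ?thesis
      using iff[OF that] pick[of e] arev_neq[OF that] by auto
  qed
  moreover have "P \<subseteq> arcs G"
  proof -
    have "(SOME e'. e' \<in> {d, arev d}) \<in> arcs G" if "d \<in> arcs G" for d
      using pick[of d] that arev_in_arcs[OF that] by auto
    then show ?thesis
      unfolding P_def S_def by blast
  qed
  ultimately show ?thesis by blast
qed

lemma edge_chains_universal:
  fixes scale :: "'a::comm_ring_1 \<Rightarrow> 'm::ab_group_add \<Rightarrow> 'm" and f :: "'e \<Rightarrow> 'm"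
  assumes "module scale" and f: "\<And>e. e \<in> arcs G \<Longrightarrow> f (arev e) = - f e"
  defines "lin \<equiv> \<lambda>h. (\<forall>c\<in>edge_chains G arev. \<forall>d\<in>edge_chains G arev. h (\<lambda>e. c e + d e) = h c + h d) \<and>
    (\<forall>a. \<forall>c\<in>edge_chains G arev. h (\<lambda>e. a * c e) = scale a (h c)) \<and>
    (\<forall>e\<in>arcs G. h (arc_chain arev e) = f e)"
  shows "\<exists>h. lin h \<and> (\<forall>h'. lin h' \<longrightarrow> (\<forall>c\<in>edge_chains G arev. h' c = h c))"
proof -
  interpret M: module scale by fact
  obtain P where P: "P \<subseteq> arcs G" "\<And>e. e \<in> arcs G \<Longrightarrow> e \<in> P \<longleftrightarrow> arev e \<notin> P"
    using orientation_exists by blast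
  have finP: "finite P"
    using P(1) finite_arcs finite_subset by blast
  define h where "h = (\<lambda>c. \<Sum>e\<in>P. scale (c e) (f e))"
  have h_arc: "h (arc_chain arev e) = f e" if "e \<in> arcs G" for e
  proof -
    have "h (arc_chain arev e)
        = (\<Sum>d\<in>P. if d = e then f d else 0) - (\<Sum>d\<in>P. if d = arev e then f d else 0)"
      unfolding h_def arc_chain_def sum_subtractf[symmetric]
      by (intro sum.cong) (auto simp: M.scale_left_diff_distrib)
    also have "\<dots> = f e"
      using P(2)[OF that] f[OF that] finP by (auto simp: sum.delta)
    finally show ?thesis .
  qed
  have "lin h"
    using h_arc
    by (simp add: lin_def h_def M.scale_left_distrib sum.distrib M.scale_sum_right)
  moreover have "h' c = h c" if h': "lin h'" and c: "c \<in> edge_chains G arev" for h' c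
  proof -
    define part where "part = (\<lambda>Q f. \<Sum>e\<in>Q. c e * arc_chain arev e f)"
    have part_chain: "part Q \<in> edge_chains G arev" if "Q \<subseteq> arcs G" for Q
    proof -
      have mem: "(arc_chain arev e :: 'e \<Rightarrow> 'a) \<in> edge_chains G arev" if "e \<in> Q" for e
        using that \<open>Q \<subseteq> arcs G\<close> by (blast intro: arc_chain_in_edge_chains)
      have "part Q (arev g) = - part Q g" if "g \<in> arcs G" for g
        unfolding part_def sum_negf[symmetric]
        by (rule sum.cong) (use mem that in \<open>auto simp: edge_chains_def\<close>)
      moreover have "part Q g = 0" if "g \<notin> arcs G" for g
        unfolding part_def by (rule sum.neutral) (use mem that in \<open>auto simp: edge_chains_def\<close>)
      ultimately show ?thesis
        by (simp add: edge_chains_def)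
    qed
    have "h' (part Q) = (\<Sum>e\<in>Q. scale (c e) (f e))" if "finite Q" "Q \<subseteq> arcs G" for Q
      using that
    proof (induction Q)
      case empty
      have z: "(\<lambda>_. 0) \<in> edge_chains G arev"
        by (simp add: edge_chains_def)
      have "\<forall>a. \<forall>c\<in>edge_chains G arev. h' (\<lambda>e. a * c e) = scale a (h' c)"
        using h' by (simp add: lin_def)
      from bspec[OF spec[OF this, of 0] z] have "h' (\<lambda>_. 0) = 0"
        by simp
      then show ?case by (simp add: part_def)
    next
      case (insert e Q)
      have ec: "(arc_chain arev e :: 'e \<Rightarrow> 'a) \<in> edge_chains G arev"
        using insert.prems by (intro arc_chain_in_edge_chains) simp
      have 1: "(\<lambda>f. c e * arc_chain arev e f) \<in> edge_chains G arev"
        using ec by (auto simp: edge_chains_def)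
      have 2: "part (insert e Q) = (\<lambda>f. c e * arc_chain arev e f + part Q f)"
        using insert.hyps by (simp add: part_def)
      have "h' (part (insert e Q)) = h' (\<lambda>f. c e * arc_chain arev e f) + h' (part Q)"
        unfolding 2 using h' 1 part_chain[of Q] insert.prems by (simp add: lin_def)
      moreover have "h' (\<lambda>f. c e * arc_chain arev e f) = scale (c e) (f e)"
        using h' ec insert.prems by (simp add: lin_def)
      ultimately show ?case
        using insert by simp
    qed
    moreover have "part P = c"
    proof
      fix g
      have "part P g = (\<Sum>e\<in>P. if e = g then c e else 0) - (\<Sum>e\<in>P. if e = arev g then c e else 0)"
        unfolding part_def arc_chain_def sum_subtractf[symmetric]
        by (intro sum.cong refl) (auto simp: of_bool_def)
      also have "\<dots> = c g"
      proof (cases "g \<in> arcs G")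
        case True
        then show ?thesis
          using P(2)[OF True] c finP by (auto simp: sum.delta edge_chains_def)
      next
        case False
        then show ?thesis
          using P(1) c finP arev_eq[OF False] by (auto simp: edge_chains_def)
      qed
      finally show "part P g = c g" .
    qed
    ultimately show "h' c = h c"
      using P(1) finP by (metis h_def)
  qed
  ultimately show ?thesis by blast
qed

end


section \<open>The cographic fan\<close>

definition cographic_arrangement :: "('v, 'e) pre_digraph \<Rightarrow> ('e \<Rightarrow> 'e) \<Rightarrow> ('e \<Rightarrow> real) set set" where
  "cographic_arrangement G arev =
     {{v \<in> homology G arev. chain_form G v (arc_chain arev e) = 0} | e.
        e \<in> arcs G \<and> (\<exists>v\<in>homology G arev. chain_form G v (arc_chain arev e) \<noteq> 0)}"

text \<open>
  The type \<^typ>\<open>'e \<Rightarrow> real\<close> carries the product topology. On functions that vanish outside the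
  finite set of arcs it is the usual topology of a finite-dimensional real vector space, and the
  homology is closed in it.
\<close>

definition cographic_chambers :: "('v, 'e) pre_digraph \<Rightarrow> ('e \<Rightarrow> 'e) \<Rightarrow> ('e \<Rightarrow> real) set set" where
  "cographic_chambers G arev =
     closure ` components (homology G arev - \<Union> (cographic_arrangement G arev))"

text \<open>
  Faces in the sense of toric geometry: zero sets, in the cone, of linear functionals on the ambient
  space that are nonnegative on the cone. (Function types are not an instance of
  \<^class>\<open>real_vector\<close>, so linearity is spelled out.)
\<close>

definition linear_functional_on :: "('e \<Rightarrow> real) set \<Rightarrow> (('e \<Rightarrow> real) \<Rightarrow> real) \<Rightarrow> bool" where
  "linear_functional_on H l \<longleftrightarrow>
     (\<forall>u\<in>H. \<forall>v\<in>H. l (\<lambda>e. u e + v e) = l u + l v) \<and> (\<forall>a. \<forall>v\<in>H. l (\<lambda>e. a * v e) = a * l v)"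

definition cone_face :: "('e \<Rightarrow> real) set \<Rightarrow> ('e \<Rightarrow> real) set \<Rightarrow> ('e \<Rightarrow> real) set \<Rightarrow> bool" where
  "cone_face H T S \<longleftrightarrow>
     (\<exists>l. linear_functional_on H l \<and> (\<forall>v\<in>S. 0 \<le> l v) \<and> T = {v \<in> S. l v = 0})"

definition cographic_fan :: "('v, 'e) pre_digraph \<Rightarrow> ('e \<Rightarrow> 'e) \<Rightarrow> ('e \<Rightarrow> real) set set" where
  "cographic_fan G arev = {T. \<exists>S\<in>cographic_chambers G arev. cone_face (homology G arev) T S}"


section \<open>The cographic ring\<close>

definition common_cone :: "('v, 'e) pre_digraph \<Rightarrow> ('e \<Rightarrow> 'e) \<Rightarrow> ('e \<Rightarrow> int) \<Rightarrow> ('e \<Rightarrow> int) \<Rightarrow> bool" where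
  "common_cone G arev c d \<longleftrightarrow>
     (\<exists>S\<in>cographic_fan G arev. (\<lambda>e. of_int (c e)) \<in> S \<and> (\<lambda>e. of_int (d e)) \<in> S)"

text \<open>
  The finitely supported function \<^term>\<open>Poly_Mapping.single c 1\<close> is the basis element $X^c$.
\<close>

definition cographic_ring ::
  "('v, 'e) pre_digraph \<Rightarrow> ('e \<Rightarrow> 'e) \<Rightarrow> (('e \<Rightarrow> int) \<Rightarrow>\<^sub>0 'k::field) ring" where
  "cographic_ring G arev =
     \<lparr>carrier = {p. Poly_Mapping.keys p \<subseteq> homology G arev},
      monoid.mult = (\<lambda>p q. \<Sum>c\<in>Poly_Mapping.keys p. \<Sum>d\<in>Poly_Mapping.keys q.
        if common_cone G arev c d
        then Poly_Mapping.single (\<lambda>e. c e + d e) (Poly_Mapping.lookup p c * Poly_Mapping.lookup q d)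
        else 0),
      one = Poly_Mapping.single (\<lambda>_. 0) 1, zero = 0, add = (+)\<rparr>"

definition cographic_const :: "'k::field \<Rightarrow> ('e \<Rightarrow> int) \<Rightarrow>\<^sub>0 'k" where
  "cographic_const a = Poly_Mapping.single (\<lambda>_. 0) a"


section \<open>The algebra of the edge variables\<close>

text \<open>
  A polynomial is a finitely supported function on monomials, a monomial a finitely supported
  function from variables to exponents. The coefficients may lie in any commutative ring, because
  base changes of the algebra are needed for the torus action.
\<close>

definition edge_poly_ring :: "('v, 'e) pre_digraph \<Rightarrow> (('e \<Rightarrow>\<^sub>0 nat) \<Rightarrow>\<^sub>0 'r::comm_ring_1) ring" where
  "edge_poly_ring G =
     \<lparr>carrier = {p. \<forall>m\<in>Poly_Mapping.keys p. Poly_Mapping.keys m \<subseteq> arcs G},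
      monoid.mult = (*), one = 1, zero = 0, add = (+)\<rparr>"

definition edge_var :: "'e \<Rightarrow> ('e \<Rightarrow>\<^sub>0 nat) \<Rightarrow>\<^sub>0 'r::comm_ring_1" where
  "edge_var e = Poly_Mapping.single (Poly_Mapping.single e 1) 1"

definition edge_ideal ::
  "('v, 'e) pre_digraph \<Rightarrow> ('e \<Rightarrow> 'e) \<Rightarrow> (('e \<Rightarrow>\<^sub>0 nat) \<Rightarrow>\<^sub>0 'r::comm_ring_1) set" where
  "edge_ideal G arev = Idl\<^bsub>edge_poly_ring G\<^esub> {edge_var (arev e) * edge_var e | e. e \<in> arcs G}"

definition edge_coset ::
  "('v, 'e) pre_digraph \<Rightarrow> ('e \<Rightarrow> 'e) \<Rightarrow> (('e \<Rightarrow>\<^sub>0 nat) \<Rightarrow>\<^sub>0 'r) \<Rightarrow> (('e \<Rightarrow>\<^sub>0 nat) \<Rightarrow>\<^sub>0 'r::comm_ring_1) set"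
  where "edge_coset G arev p = edge_ideal G arev +>\<^bsub>edge_poly_ring G\<^esub> p"

definition edge_algebra ::
  "('v, 'e) pre_digraph \<Rightarrow> ('e \<Rightarrow> 'e) \<Rightarrow> (('e \<Rightarrow>\<^sub>0 nat) \<Rightarrow>\<^sub>0 'r::comm_ring_1) set ring" where
  "edge_algebra G arev = edge_poly_ring G Quot edge_ideal G arev"

definition edge_const ::
  "('v, 'e) pre_digraph \<Rightarrow> ('e \<Rightarrow> 'e) \<Rightarrow> 'r::comm_ring_1 \<Rightarrow> (('e \<Rightarrow>\<^sub>0 nat) \<Rightarrow>\<^sub>0 'r) set" where
  "edge_const G arev a = edge_coset G arev (Poly_Mapping.single 0 a)"


section \<open>The torus action and its invariants\<close>

definition unital_ring_hom :: "('k::comm_ring_1 \<Rightarrow> 'r::comm_ring_1) \<Rightarrow> bool" where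
  "unital_ring_hom \<phi> \<longleftrightarrow>
     \<phi> 1 = 1 \<and> (\<forall>a b. \<phi> (a + b) = \<phi> a + \<phi> b) \<and> (\<forall>a b. \<phi> (a * b) = \<phi> a * \<phi> b)"

text \<open>
  A point of the torus over a ring is given together with its inverse: a pair \<open>l\<close>, \<open>l'\<close> of families
  indexed by the vertices with $l_v l'_v = 1$.
\<close>

definition torus_point :: "('v, 'e) pre_digraph \<Rightarrow> ('v \<Rightarrow> 'r::comm_ring_1) \<Rightarrow> ('v \<Rightarrow> 'r) \<Rightarrow> bool" where
  "torus_point G l l' \<longleftrightarrow> (\<forall>v\<in>verts G. l v * l' v = 1)"

text \<open>
  The endomorphism of polynomials over \<^typ>\<open>'r\<close> that multiplies each variable \<^term>\<open>edge_var e\<close> by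
  \<^term>\<open>l (tail G e) * l' (head G e)\<close>, written out on monomials; see \<open>torus_act_edge_var\<close> below.
\<close>

definition torus_act ::
  "('v, 'e) pre_digraph \<Rightarrow> ('v \<Rightarrow> 'r) \<Rightarrow> ('v \<Rightarrow> 'r) \<Rightarrow>
   (('e \<Rightarrow>\<^sub>0 nat) \<Rightarrow>\<^sub>0 'r) \<Rightarrow> (('e \<Rightarrow>\<^sub>0 nat) \<Rightarrow>\<^sub>0 'r::comm_ring_1)" where
  "torus_act G l l' p = (\<Sum>m\<in>Poly_Mapping.keys p. Poly_Mapping.single m
     (Poly_Mapping.lookup p m *
        (\<Prod>e\<in>Poly_Mapping.keys m. (l (tail G e) * l' (head G e)) ^ Poly_Mapping.lookup m e)))"

text \<open>The map of quotients induced by a map of polynomials that respects the ideals.\<close>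

definition edge_induced ::
  "('v, 'e) pre_digraph \<Rightarrow> ('e \<Rightarrow> 'e) \<Rightarrow> ((('e \<Rightarrow>\<^sub>0 nat) \<Rightarrow>\<^sub>0 'k) \<Rightarrow> (('e \<Rightarrow>\<^sub>0 nat) \<Rightarrow>\<^sub>0 'r)) \<Rightarrow>
   (('e \<Rightarrow>\<^sub>0 nat) \<Rightarrow>\<^sub>0 'k::comm_ring_1) set \<Rightarrow> (('e \<Rightarrow>\<^sub>0 nat) \<Rightarrow>\<^sub>0 'r::comm_ring_1) set" where
  "edge_induced G arev f X = (\<Union>p\<in>X. edge_coset G arev (f p))"

text \<open>
  An element \<open>X\<close> of the algebra over \<open>k\<close> is fixed over a ring \<open>R\<close> if, for every \<open>k\<close>-algebra structure
  \<open>\<phi>\<close> on \<open>R\<close>, its image in the base change to \<open>R\<close> is fixed by all \<open>R\<close>-points of the torus.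
\<close>

definition torus_fixed_over ::
  "'r::comm_ring_1 itself \<Rightarrow> ('v, 'e) pre_digraph \<Rightarrow> ('e \<Rightarrow> 'e) \<Rightarrow> (('e \<Rightarrow>\<^sub>0 nat) \<Rightarrow>\<^sub>0 'k::field) set \<Rightarrow> bool" where
  "torus_fixed_over _ G arev X \<longleftrightarrow>
     (\<forall>(\<phi> :: 'k \<Rightarrow> 'r::comm_ring_1) l l'. unital_ring_hom \<phi> \<longrightarrow> torus_point G l l' \<longrightarrow>
        edge_induced G arev (\<lambda>p. torus_act G l l' (Poly_Mapping.map \<phi> p)) X =
        edge_induced G arev (Poly_Mapping.map \<phi>) X)"

text \<open>
  Invariance under the group scheme means being fixed over every \<open>k\<close>-algebra. A definition cannot
  quantify over types, but it is enough to take the ring of Laurent polynomials in the vertices: it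
  contains the coordinate ring of the torus, hence the universal point. That elements fixed over
  this ring are fixed over all rings is the lemma \<open>torus_invariants_fixed_over\<close>.
\<close>

definition torus_invariants ::
  "('v, 'e) pre_digraph \<Rightarrow> ('e \<Rightarrow> 'e) \<Rightarrow> (('e \<Rightarrow>\<^sub>0 nat) \<Rightarrow>\<^sub>0 'k::field) set set" where
  "torus_invariants G arev =
     {X \<in> carrier (edge_algebra G arev). torus_fixed_over TYPE(('v \<Rightarrow>\<^sub>0 int) \<Rightarrow>\<^sub>0 'k) G arev X}"

context finite_graph
begin

lemma edge_poly_ring_cring: "cring (edge_poly_ring G :: (('e \<Rightarrow>\<^sub>0 nat) \<Rightarrow>\<^sub>0 'r::comm_ring_1) ring)"
proof -
  let ?R = "edge_poly_ring G :: (('e \<Rightarrow>\<^sub>0 nat) \<Rightarrow>\<^sub>0 'r) ring"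
  have mult: "p * q \<in> carrier ?R" if "p \<in> carrier ?R" "q \<in> carrier ?R" for p q
  proof -
    have "Poly_Mapping.keys m \<subseteq> arcs G" if m: "m \<in> Poly_Mapping.keys (p * q)" for m
    proof -
      from m keys_mult[of p q] obtain a b
        where "m = a + b" "a \<in> Poly_Mapping.keys p" "b \<in> Poly_Mapping.keys q" by blast
      then show ?thesis
        using keys_add[of a b] \<open>p \<in> carrier ?R\<close> \<open>q \<in> carrier ?R\<close>
        by (fastforce simp: edge_poly_ring_def)
    qed
    then show ?thesis by (auto simp: edge_poly_ring_def)
  qed
  have add: "p + q \<in> carrier ?R" if "p \<in> carrier ?R" "q \<in> carrier ?R" for p q
    using that keys_add[of p q] by (fastforce simp: edge_poly_ring_def)
  have neg: "- p \<in> carrier ?R" if "p \<in> carrier ?R" for p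
    using that by (auto simp: edge_poly_ring_def in_keys_iff)
  have zero_one: "0 \<in> carrier ?R" "1 \<in> carrier ?R"
    by (auto simp: edge_poly_ring_def)
  have ops: "x \<otimes>\<^bsub>?R\<^esub> y = x * y" "x \<oplus>\<^bsub>?R\<^esub> y = x + y" "\<zero>\<^bsub>?R\<^esub> = 0" "\<one>\<^bsub>?R\<^esub> = 1" for x y
    by (simp_all add: edge_poly_ring_def)
  show ?thesis
  proof (rule cringI)
    show "abelian_group ?R"
    proof (rule abelian_groupI)
      show "\<exists>q\<in>carrier ?R. q \<oplus>\<^bsub>?R\<^esub> p = \<zero>\<^bsub>?R\<^esub>" if "p \<in> carrier ?R" for p
        using neg[OF that] by (intro bexI[of _ "- p"]) (simp_all add: ops)
    qed (simp_all only: ops add zero_one ac_simps add_0 add_0_right)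
    show "Group.comm_monoid ?R"
      by (rule comm_monoidI) (simp_all only: ops mult zero_one ac_simps mult_1 mult_1_right)
  qed (simp only: ops distrib_right)
qed

definition vanishing :: "('e \<Rightarrow>\<^sub>0 nat) \<Rightarrow> bool" where
  "vanishing m \<longleftrightarrow> (\<exists>e\<in>arcs G. Poly_Mapping.lookup m e > 0 \<and> Poly_Mapping.lookup m (arev e) > 0)"

lemma edge_ideal_ideal:
  "ideal (edge_ideal G arev :: (('e \<Rightarrow>\<^sub>0 nat) \<Rightarrow>\<^sub>0 'r::comm_ring_1) set) (edge_poly_ring G)"
proof -
  interpret cring "edge_poly_ring G :: (('e \<Rightarrow>\<^sub>0 nat) \<Rightarrow>\<^sub>0 'r) ring"
    by (rule edge_poly_ring_cring)
  show ?thesis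
    unfolding edge_ideal_def
  proof (rule genideal_ideal)
    have "edge_var e \<in> carrier (edge_poly_ring G :: (('e \<Rightarrow>\<^sub>0 nat) \<Rightarrow>\<^sub>0 'r) ring)"
      if "e \<in> arcs G" for e
      using that by (auto simp: edge_var_def edge_poly_ring_def)
    then have "edge_var (arev e) \<otimes>\<^bsub>edge_poly_ring G\<^esub> edge_var e
        \<in> carrier (edge_poly_ring G :: (('e \<Rightarrow>\<^sub>0 nat) \<Rightarrow>\<^sub>0 'r) ring)" if "e \<in> arcs G" for e
      using that by (intro m_closed) auto
    then show "{edge_var (arev e) * edge_var e |e. e \<in> arcs G}
        \<subseteq> carrier (edge_poly_ring G :: (('e \<Rightarrow>\<^sub>0 nat) \<Rightarrow>\<^sub>0 'r) ring)"
      by (auto simp: edge_poly_ring_def)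
  qed
qed

lemma poly_mapping_sum_single:
  "p = (\<Sum>m\<in>Poly_Mapping.keys p. Poly_Mapping.single m (Poly_Mapping.lookup p m))"
  by (rule poly_mapping_eqI)
    (auto simp: lookup_sum lookup_single when_def sum.delta in_keys_iff)

lemma edge_ideal_iff:
  fixes p :: "('e \<Rightarrow>\<^sub>0 nat) \<Rightarrow>\<^sub>0 'r::comm_ring_1"
  shows "p \<in> edge_ideal G arev \<longleftrightarrow>
    p \<in> carrier (edge_poly_ring G) \<and> (\<forall>m\<in>Poly_Mapping.keys p. vanishing m)"
proof -
  let ?R = "edge_poly_ring G :: (('e \<Rightarrow>\<^sub>0 nat) \<Rightarrow>\<^sub>0 'r) ring"
  let ?I = "edge_ideal G arev :: (('e \<Rightarrow>\<^sub>0 nat) \<Rightarrow>\<^sub>0 'r) set"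
  let ?J = "{p \<in> carrier ?R. \<forall>m\<in>Poly_Mapping.keys p. vanishing m}"
  interpret R: cring ?R by (rule edge_poly_ring_cring)
  interpret I: ideal ?I ?R by (rule edge_ideal_ideal)
  have ops: "x \<otimes>\<^bsub>?R\<^esub> y = x * y" "x \<oplus>\<^bsub>?R\<^esub> y = x + y" "\<zero>\<^bsub>?R\<^esub> = 0" for x y
    by (auto simp: edge_poly_ring_def)
  have vanish_add: "vanishing (a + b)" if "vanishing a" for a b
    using that by (auto simp: vanishing_def lookup_add)
  have J_mult: "x * y \<in> ?J" if "x \<in> ?J" "y \<in> carrier ?R" for x y
  proof -
    have "x * y \<in> carrier ?R"
      using R.m_closed[of x y] that by (simp add: ops)
    moreover have "vanishing m" if "m \<in> Poly_Mapping.keys (x * y)" for m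
      using that keys_mult[of x y] \<open>x \<in> ?J\<close> vanish_add by fastforce
    ultimately show ?thesis by auto
  qed
  have "ideal ?J ?R"
  proof (rule idealI)
    show "ring ?R" by (rule R.ring_axioms)
    show "subgroup ?J (add_monoid ?R)"
    proof (rule R.add.subgroupI)
      show "?J \<subseteq> carrier ?R" by auto
      have "0 \<in> ?J" by (auto simp: edge_poly_ring_def)
      then show "?J \<noteq> {}" by blast
      show "\<ominus>\<^bsub>?R\<^esub> a \<in> ?J" if "a \<in> ?J" for a
      proof -
        have J: "- a \<in> ?J"
          using that by (auto simp: edge_poly_ring_def in_keys_iff)
        have "\<ominus>\<^bsub>?R\<^esub> a = - a"
          by (rule R.minus_equality) (use that J in \<open>simp_all add: ops\<close>)
        with J show ?thesis by (simp only:)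
      qed
      show "a \<oplus>\<^bsub>?R\<^esub> b \<in> ?J" if "a \<in> ?J" "b \<in> ?J" for a b
      proof -
        have "a + b \<in> carrier ?R"
          using that R.a_closed[of a b] by (simp add: ops)
        moreover have "vanishing m" if "m \<in> Poly_Mapping.keys (a + b)" for m
          using that keys_add[of a b] \<open>a \<in> ?J\<close> \<open>b \<in> ?J\<close> by blast
        ultimately show ?thesis by (simp add: ops)
      qed
    qed
    show "x \<otimes>\<^bsub>?R\<^esub> a \<in> ?J" "a \<otimes>\<^bsub>?R\<^esub> x \<in> ?J" if "a \<in> ?J" "x \<in> carrier ?R" for a x
      using J_mult[OF that] unfolding ops by (simp_all only: mult.commute)
  qed
  moreover have "edge_var (arev e) * edge_var e \<in> ?J" if "e \<in> arcs G" for e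
  proof -
    have "edge_var e \<in> carrier ?R" "edge_var (arev e) \<in> carrier ?R"
      using that by (auto simp: edge_var_def edge_poly_ring_def)
    then have "edge_var (arev e) * edge_var e \<in> carrier ?R"
      using R.m_closed[of "edge_var (arev e)" "edge_var e"] by (simp add: ops)
    moreover have "vanishing (Poly_Mapping.single (arev e) 1 + Poly_Mapping.single e 1)"
      using that unfolding vanishing_def lookup_add by (intro bexI[of _ e]) simp_all
    ultimately show ?thesis
      by (auto simp: edge_var_def mult_single)
  qed
  ultimately have "?I \<subseteq> ?J"
    unfolding edge_ideal_def by (intro R.genideal_minimal) blast+
  moreover have "p \<in> ?I" if p: "p \<in> ?J" for p
  proof -
    have mono: "Poly_Mapping.single m a \<in> ?I"
      if m: "vanishing m" "Poly_Mapping.keys m \<subseteq> arcs G" for m a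
    proof -
      from m obtain e where e: "e \<in> arcs G" "Poly_Mapping.lookup m e > 0"
        "Poly_Mapping.lookup m (arev e) > 0" by (auto simp: vanishing_def)
      define u where "u = Poly_Mapping.single (arev e) 1 + Poly_Mapping.single e (1::nat)"
      have m_eq: "m = u + (m - u)"
        using e arev_neq[OF e(1)]
        by (intro poly_mapping_eqI)
          (auto simp: u_def lookup_add lookup_minus lookup_single when_def)
      have "edge_var (arev e) * edge_var e \<in> ?I"
      proof -
        have "{edge_var (arev e) * edge_var e |e. e \<in> arcs G} \<subseteq> ?I"
          unfolding edge_ideal_def genideal_def by blast
        with e show ?thesis by blast
      qed
      then have u: "Poly_Mapping.single u 1 \<in> ?I"
        by (simp add: edge_var_def mult_single u_def)
      have "Poly_Mapping.keys (m - u) \<subseteq> Poly_Mapping.keys m"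
        by (auto simp: in_keys_iff lookup_minus)
      then have "Poly_Mapping.single (m - u) a \<in> carrier ?R"
        using m by (auto simp: edge_poly_ring_def)
      from I.I_r_closed[OF u this] have "Poly_Mapping.single (u + (m - u)) a \<in> ?I"
        by (simp add: ops mult_single)
      with m_eq show ?thesis by simp
    qed
    have sum: "(\<Sum>m\<in>M. Poly_Mapping.single m (Poly_Mapping.lookup p m)) \<in> ?I"
      if "finite M" "M \<subseteq> Poly_Mapping.keys p" for M
      using that
    proof (induction M)
      case empty
      show ?case using I.zero_closed by (simp add: ops)
    next
      case (insert m M)
      have "Poly_Mapping.single m (Poly_Mapping.lookup p m) \<in> ?I"
        using insert.prems p by (intro mono) (auto simp: edge_poly_ring_def)
      with insert I.a_closed show ?case by (auto simp: ops)
    qed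
    show ?thesis
      using sum[of "Poly_Mapping.keys p"] poly_mapping_sum_single[of p] by simp
  qed
  ultimately show ?thesis by blast
qed

lemma edge_coset_eq_iff:
  fixes p q :: "('e \<Rightarrow>\<^sub>0 nat) \<Rightarrow>\<^sub>0 'r::comm_ring_1"
  assumes "p \<in> carrier (edge_poly_ring G)" "q \<in> carrier (edge_poly_ring G)"
  shows "edge_coset G arev p = edge_coset G arev q \<longleftrightarrow>
    (\<forall>m. \<not> vanishing m \<longrightarrow> Poly_Mapping.lookup p m = Poly_Mapping.lookup q m)"
proof -
  let ?R = "edge_poly_ring G :: (('e \<Rightarrow>\<^sub>0 nat) \<Rightarrow>\<^sub>0 'r) ring"
  interpret R: cring ?R by (rule edge_poly_ring_cring)
  interpret I: ideal "edge_ideal G arev" ?R by (rule edge_ideal_ideal)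
  have ops: "x \<oplus>\<^bsub>?R\<^esub> y = x + y" "\<zero>\<^bsub>?R\<^esub> = 0" for x y
    by (auto simp: edge_poly_ring_def)
  have neg: "\<ominus>\<^bsub>?R\<^esub> q = - q"
    using assms(2) by (intro R.minus_equality) (auto simp: ops edge_poly_ring_def in_keys_iff)
  have "p \<ominus>\<^bsub>?R\<^esub> q = p - q"
    unfolding a_minus_def neg by (simp add: ops)
  moreover have "p \<ominus>\<^bsub>?R\<^esub> q \<in> carrier ?R"
    using assms by simp
  moreover have "edge_coset G arev p = edge_coset G arev q \<longleftrightarrow> p \<ominus>\<^bsub>?R\<^esub> q \<in> edge_ideal G arev"
    using assms R.quotient_eq_iff_same_a_r_cos[OF I.ideal_axioms] unfolding edge_coset_def
    by blast
  ultimately show ?thesis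
    by (auto simp: edge_ideal_iff in_keys_iff lookup_minus)
qed

lemma edge_induced_coset:
  fixes f :: "(('e \<Rightarrow>\<^sub>0 nat) \<Rightarrow>\<^sub>0 'k::comm_ring_1) \<Rightarrow> (('e \<Rightarrow>\<^sub>0 nat) \<Rightarrow>\<^sub>0 'r::comm_ring_1)"
  assumes p: "p \<in> carrier (edge_poly_ring G)"
    and f: "\<And>q. q \<in> carrier (edge_poly_ring G) \<Longrightarrow> f q \<in> carrier (edge_poly_ring G)"
    and f': "\<And>q m. Poly_Mapping.lookup q m = Poly_Mapping.lookup p m \<Longrightarrow>
      Poly_Mapping.lookup (f q) m = Poly_Mapping.lookup (f p) m"
  shows "edge_induced G arev f (edge_coset G arev p) = edge_coset G arev (f p)"
proof -
  interpret R: cring "edge_poly_ring G :: (('e \<Rightarrow>\<^sub>0 nat) \<Rightarrow>\<^sub>0 'k) ring" by (rule edge_poly_ring_cring)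
  interpret I: ideal "edge_ideal G arev" "edge_poly_ring G :: (('e \<Rightarrow>\<^sub>0 nat) \<Rightarrow>\<^sub>0 'k) ring"
    by (rule edge_ideal_ideal)
  have self: "p \<in> edge_coset G arev p"
    unfolding edge_coset_def using p by (rule I.a_rcos_self)
  have "edge_coset G arev (f q) = edge_coset G arev (f p)" if q: "q \<in> edge_coset G arev p" for q
  proof -
    have qc: "q \<in> carrier (edge_poly_ring G)"
      using q p R.a_r_coset_subset_G[of "edge_ideal G arev" p] I.a_subset
      unfolding edge_coset_def by blast
    have "edge_coset G arev q = edge_coset G arev p"
      using R.a_repr_independence[OF _ p I.a_subgroup] q unfolding edge_coset_def by metis
    then have "\<forall>m. \<not> vanishing m \<longrightarrow> Poly_Mapping.lookup q m = Poly_Mapping.lookup p m"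
      using edge_coset_eq_iff p qc by blast
    then show ?thesis
      unfolding edge_coset_eq_iff[OF f[OF qc] f[OF p]] using f' by blast
  qed
  with self show ?thesis
    unfolding edge_induced_def by blast
qed

abbreviation torus_char :: "('v \<Rightarrow> 'r::comm_ring_1) \<Rightarrow> ('v \<Rightarrow> 'r) \<Rightarrow> ('e \<Rightarrow>\<^sub>0 nat) \<Rightarrow> 'r" where
  "torus_char l l' m \<equiv>
     (\<Prod>e\<in>Poly_Mapping.keys m. (l (tail G e) * l' (head G e)) ^ Poly_Mapping.lookup m e)"

lemma lookup_torus_act:
  "Poly_Mapping.lookup (torus_act G l l' p) m = Poly_Mapping.lookup p m * torus_char l l' m"
  by (auto simp: torus_act_def lookup_sum lookup_single when_def sum.delta in_keys_iff)

lemma torus_act_edge_var: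
  fixes l l' :: "'v \<Rightarrow> 'r::comm_ring_1"
  shows "torus_act G l l' (edge_var e) =
    Poly_Mapping.single 0 (l (tail G e)) * edge_var e * Poly_Mapping.single 0 (l' (head G e))"
  by (simp add: torus_act_def edge_var_def mult_single)

lemma lookup_map_hom:
  assumes "unital_ring_hom \<phi>"
  shows "Poly_Mapping.lookup (Poly_Mapping.map \<phi> p) m = \<phi> (Poly_Mapping.lookup p m)"
proof -
  have "\<phi> 0 = 0"
    using assms unfolding unital_ring_hom_def by (metis add_cancel_right_right)
  then show ?thesis
    by (simp add: Poly_Mapping.map.rep_eq when_def)
qed

lemma edge_carrier_iff:
  "p \<in> carrier (edge_poly_ring G) \<longleftrightarrow>
    (\<forall>m. Poly_Mapping.lookup p m \<noteq> 0 \<longrightarrow> Poly_Mapping.keys m \<subseteq> arcs G)"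
  by (auto simp: edge_poly_ring_def in_keys_iff)

lemma torus_fixed_over_iff:
  fixes p :: "('e \<Rightarrow>\<^sub>0 nat) \<Rightarrow>\<^sub>0 'k::field"
  assumes p: "p \<in> carrier (edge_poly_ring G)"
  shows "torus_fixed_over TYPE('r::comm_ring_1) G arev (edge_coset G arev p) \<longleftrightarrow>
    (\<forall>(\<phi> :: 'k \<Rightarrow> 'r) l l' m. unital_ring_hom \<phi> \<longrightarrow> torus_point G l l' \<longrightarrow> \<not> vanishing m \<longrightarrow>
      \<phi> (Poly_Mapping.lookup p m) * torus_char l l' m = \<phi> (Poly_Mapping.lookup p m))"
proof -
  have "edge_induced G arev (\<lambda>p. torus_act G l l' (Poly_Mapping.map \<phi> p)) (edge_coset G arev p) =
        edge_induced G arev (Poly_Mapping.map \<phi>) (edge_coset G arev p) \<longleftrightarrow>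
      (\<forall>m. \<not> vanishing m \<longrightarrow>
        \<phi> (Poly_Mapping.lookup p m) * torus_char l l' m = \<phi> (Poly_Mapping.lookup p m))"
    if \<phi>: "unital_ring_hom \<phi>" for \<phi> :: "'k \<Rightarrow> 'r" and l l'
  proof -
    have "\<phi> 0 = 0"
      using \<phi> unfolding unital_ring_hom_def by (metis add_cancel_right_right)
    note \<phi>0 = this
    have c1: "Poly_Mapping.map \<phi> q \<in> carrier (edge_poly_ring G)"
      if "q \<in> carrier (edge_poly_ring G)" for q
      using that \<phi>0 unfolding edge_carrier_iff lookup_map_hom[OF \<phi>] by metis
    have c2: "torus_act G l l' (Poly_Mapping.map \<phi> q) \<in> carrier (edge_poly_ring G)"
      if "q \<in> carrier (edge_poly_ring G)" for q
      using c1[OF that] unfolding edge_carrier_iff lookup_torus_act by (metis mult_zero_left)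
    have 1: "edge_induced G arev (Poly_Mapping.map \<phi>) (edge_coset G arev p) =
        edge_coset G arev (Poly_Mapping.map \<phi> p)"
      by (rule edge_induced_coset[OF p c1]) (auto simp: lookup_map_hom[OF \<phi>])
    have 2: "edge_induced G arev (\<lambda>p. torus_act G l l' (Poly_Mapping.map \<phi> p)) (edge_coset G arev p) =
        edge_coset G arev (torus_act G l l' (Poly_Mapping.map \<phi> p))"
      by (rule edge_induced_coset[OF p c2]) (auto simp: lookup_map_hom[OF \<phi>] lookup_torus_act)
    show ?thesis
      unfolding 1 2 edge_coset_eq_iff[OF c2[OF p] c1[OF p]] lookup_torus_act lookup_map_hom[OF \<phi>] ..
  qed
  then show ?thesis
    unfolding torus_fixed_over_def by blast
qed

lemma torus_char_eq_1:
  fixes l l' :: "'v \<Rightarrow> 'r::comm_ring_1"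
  assumes l: "torus_point G l l'" and m: "Poly_Mapping.keys m \<subseteq> arcs G"
    and balanced: "\<And>v. (\<Sum>e | e \<in> arcs G \<and> tail G e = v. Poly_Mapping.lookup m e) =
      (\<Sum>e | e \<in> arcs G \<and> head G e = v. Poly_Mapping.lookup m e)"
  shows "torus_char l l' m = 1"
proof -
  have grp: "(\<Prod>e\<in>arcs G. x (g e) ^ Poly_Mapping.lookup m e) =
      (\<Prod>v\<in>verts G. x v ^ (\<Sum>e | e \<in> arcs G \<and> g e = v. Poly_Mapping.lookup m e))"
    if "g ` arcs G \<subseteq> verts G" for x :: "'v \<Rightarrow> 'r" and g
    using prod.group[OF finite_arcs finite_verts that,
        of "\<lambda>e. x (g e) ^ Poly_Mapping.lookup m e", symmetric]
    by (simp add: power_sum)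
  have "torus_char l l' m = (\<Prod>e\<in>arcs G. (l (tail G e) * l' (head G e)) ^ Poly_Mapping.lookup m e)"
    by (rule prod.mono_neutral_left) (use m in \<open>auto simp: in_keys_iff\<close>)
  also have "\<dots> = (\<Prod>e\<in>arcs G. l (tail G e) ^ Poly_Mapping.lookup m e) *
      (\<Prod>e\<in>arcs G. l' (head G e) ^ Poly_Mapping.lookup m e)"
    by (simp add: power_mult_distrib prod.distrib)
  also have "\<dots> = (\<Prod>v\<in>verts G.
      (l v * l' v) ^ (\<Sum>e | e \<in> arcs G \<and> tail G e = v. Poly_Mapping.lookup m e))"
    using grp[of "tail G" l] grp[of "head G" l']
    by (simp add: image_subset_iff balanced power_mult_distrib prod.distrib)
  also have "\<dots> = 1"
    using l by (intro prod.neutral) (auto simp: torus_point_def)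
  finally show ?thesis .
qed

lemma torus_char_universal:
  fixes m :: "'e \<Rightarrow>\<^sub>0 nat"
  shows "torus_char (\<lambda>v. Poly_Mapping.single (Poly_Mapping.single v (1::int)) (1::'k::field))
      (\<lambda>v. Poly_Mapping.single (Poly_Mapping.single v (-1)) 1) m =
    Poly_Mapping.single (\<Sum>e\<in>Poly_Mapping.keys m.
      Poly_Mapping.single (tail G e) (int (Poly_Mapping.lookup m e)) -
      Poly_Mapping.single (head G e) (int (Poly_Mapping.lookup m e))) 1"
proof -
  have pow: "Poly_Mapping.single u (1::'k) ^ n =
      Poly_Mapping.single (\<Sum>i<n. u) 1" for u :: "'v \<Rightarrow>\<^sub>0 int" and n
    by (induction n) (auto simp: mult_single add.commute)
  have sum_const: "(\<Sum>i<n. Poly_Mapping.single a (1::int) + Poly_Mapping.single b (-1)) =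
      Poly_Mapping.single a (int n) - Poly_Mapping.single b (int n)" for a b :: 'v and n
    by (rule poly_mapping_eqI)
      (auto simp: lookup_sum lookup_add lookup_minus lookup_single when_def)
  have prod: "(\<Prod>e\<in>M. Poly_Mapping.single (w e) (1::'k)) =
      Poly_Mapping.single (\<Sum>e\<in>M. w e) 1" if "finite M" for M and w :: "'e \<Rightarrow> 'v \<Rightarrow>\<^sub>0 int"
    using that by (induction M) (auto simp: mult_single)
  show ?thesis
    by (simp add: mult_single pow sum_const prod)
qed

end

lemma (in finite_graph) torus_invariants_fixed_over:
  fixes X :: "(('e \<Rightarrow>\<^sub>0 nat) \<Rightarrow>\<^sub>0 'k::field) set"
  assumes "X \<in> torus_invariants G arev"
  shows "torus_fixed_over TYPE('r::comm_ring_1) G arev X"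
proof -
  let ?A = "edge_poly_ring G :: (('e \<Rightarrow>\<^sub>0 nat) \<Rightarrow>\<^sub>0 'k) ring"
  from assms obtain p where p: "p \<in> carrier ?A" and X: "X = edge_coset G arev p"
    by (auto simp: torus_invariants_def edge_algebra_def FactRing_def A_RCOSETS_def'
        a_r_coset_def' edge_coset_def)
  let ?l = "\<lambda>v. Poly_Mapping.single (Poly_Mapping.single v (1::int)) (1::'k)"
  let ?l' = "\<lambda>v. Poly_Mapping.single (Poly_Mapping.single v (-1::int)) (1::'k)"
  let ?w = "\<lambda>m. \<Sum>e\<in>Poly_Mapping.keys m.
      Poly_Mapping.single (tail G e) (int (Poly_Mapping.lookup m e)) -
      Poly_Mapping.single (head G e) (int (Poly_Mapping.lookup m e))"
  have point: "torus_point G ?l ?l'"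
    by (auto simp: torus_point_def mult_single simp flip: single_add)
  have hom: "unital_ring_hom (Poly_Mapping.single (0 :: 'v \<Rightarrow>\<^sub>0 int) :: 'k \<Rightarrow> _)"
    by (auto simp: unital_ring_hom_def single_add mult_single)
  have weight: "?w m = 0" if "\<not> vanishing m" "Poly_Mapping.lookup p m \<noteq> 0" for m
  proof -
    have "Poly_Mapping.single 0 (Poly_Mapping.lookup p m) * torus_char ?l ?l' m =
        Poly_Mapping.single 0 (Poly_Mapping.lookup p m)"
      using assms that(1) hom point
      unfolding torus_invariants_def X mem_Collect_eq torus_fixed_over_iff[OF p] by blast
    then have eq: "Poly_Mapping.single (?w m) (Poly_Mapping.lookup p m) =
        Poly_Mapping.single 0 (Poly_Mapping.lookup p m)"
      unfolding torus_char_universal by (simp add: mult_single)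
    then have "Poly_Mapping.keys (Poly_Mapping.single (?w m) (Poly_Mapping.lookup p m)) =
        Poly_Mapping.keys (Poly_Mapping.single 0 (Poly_Mapping.lookup p m))" by simp
    with that(2) show ?thesis by simp
  qed
  have char1: "torus_char l l' m = 1"
    if l: "torus_point G l l'" and m: "\<not> vanishing m" "Poly_Mapping.lookup p m \<noteq> 0"
    for l l' :: "'v \<Rightarrow> 'r" and m
  proof (rule torus_char_eq_1[OF l])
    show km: "Poly_Mapping.keys m \<subseteq> arcs G"
      using p m by (auto simp: edge_carrier_iff)
    fix v
    have "0 = Poly_Mapping.lookup (?w m) v"
      using weight[OF m] by simp
    also have "\<dots> = (\<Sum>e\<in>Poly_Mapping.keys m.
        (if tail G e = v then int (Poly_Mapping.lookup m e) else 0) -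
        (if head G e = v then int (Poly_Mapping.lookup m e) else 0))"
      by (simp add: lookup_sum lookup_minus lookup_single when_def)
    also have "\<dots> = (\<Sum>e\<in>arcs G.
        (if tail G e = v then int (Poly_Mapping.lookup m e) else 0) -
        (if head G e = v then int (Poly_Mapping.lookup m e) else 0))"
      by (rule sum.mono_neutral_left) (use km in \<open>auto simp: in_keys_iff\<close>)
    also have "\<dots> = int (\<Sum>e | e \<in> arcs G \<and> tail G e = v. Poly_Mapping.lookup m e) -
        int (\<Sum>e | e \<in> arcs G \<and> head G e = v. Poly_Mapping.lookup m e)"
      by (simp add: sum_subtractf sum.inter_filter[symmetric])
    finally show "(\<Sum>e | e \<in> arcs G \<and> tail G e = v. Poly_Mapping.lookup m e) =
        (\<Sum>e | e \<in> arcs G \<and> head G e = v. Poly_Mapping.lookup m e)" by linarith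
  qed
  have "\<phi> (Poly_Mapping.lookup p m) * torus_char l l' m = \<phi> (Poly_Mapping.lookup p m)"
    if \<phi>: "unital_ring_hom \<phi>" and l: "torus_point G l l'" and m: "\<not> vanishing m"
    for \<phi> :: "'k \<Rightarrow> 'r" and l l' m
  proof (cases "Poly_Mapping.lookup p m = 0")
    case True
    have "\<phi> 0 = 0"
      using \<phi> unfolding unital_ring_hom_def by (metis add_cancel_right_right)
    with True show ?thesis by simp
  qed (use char1[OF l m] in simp)
  then show ?thesis
    unfolding X torus_fixed_over_iff[OF p] by blast
qed

definition invariant_ring ::
  "('v, 'e) pre_digraph \<Rightarrow> ('e \<Rightarrow> 'e) \<Rightarrow> (('e \<Rightarrow>\<^sub>0 nat) \<Rightarrow>\<^sub>0 'k::field) set ring" where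
  "invariant_ring G arev = (edge_algebra G arev)\<lparr>carrier := torus_invariants G arev\<rparr>"

text \<open>
  Isomorphism of algebras over \<^typ>\<open>'k\<close>, each given by a ring and the structure map into it.
\<close>

definition k_algebra_iso :: "('a, 'm) ring_scheme \<Rightarrow> ('k::field \<Rightarrow> 'a) \<Rightarrow>
    ('b, 'n) ring_scheme \<Rightarrow> ('k \<Rightarrow> 'b) \<Rightarrow> bool" where
  "k_algebra_iso A \<iota>A B \<iota>B \<longleftrightarrow> (\<exists>h\<in>ring_iso A B. \<forall>a. h (\<iota>A a) = \<iota>B a)"

end

theory Submission
  imports Defs
begin

text \<open>
  Sending a chain \<open>c\<close> to the monomial whose exponents are the positive parts of the values of \<open>c\<close>
  identifies the integral chains with the monomials that are not divisible by any
  $U_{\overleftarrow{e}} U_{\overrightarrow{e}}$, and the cycles with those of weight zero under the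
  torus. The monomials of two cycles \<open>c\<close>, \<open>d\<close> multiply to zero exactly if \<open>c\<close> and \<open>d\<close> have opposite
  signs on some edge; since sign-compatible cycles can be perturbed to a common chamber, this says
  that they lie in no common cone of the fan.
\<close>

text \<open>The isomorphism is easier to construct out of \<open>cographic_ring\<close>, where a map
  is prescribed on the basis, and is inverted afterwards. Closure of the carrier under the
  operations is what allows \<open>h\<close> to be cancelled on products and sums of preimages; the
  ring axioms of \<open>R\<close> do not have to be established first.\<close>

lemma ring_iso_inv_into:
  assumes h: "h \<in> ring_iso R S"
    and m: "\<And>x y. x \<in> carrier R \<Longrightarrow> y \<in> carrier R \<Longrightarrow> x \<otimes>\<^bsub>R\<^esub> y \<in> carrier R"
    and a: "\<And>x y. x \<in> carrier R \<Longrightarrow> y \<in> carrier R \<Longrightarrow> x \<oplus>\<^bsub>R\<^esub> y \<in> carrier R"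
    and o: "\<one>\<^bsub>R\<^esub> \<in> carrier R"
  shows "inv_into (carrier R) h \<in> ring_iso S R"
proof -
  have hom: "h \<in> ring_hom R S" and bij: "bij_betw h (carrier R) (carrier S)"
    using h by (auto simp: ring_iso_def)
  let ?g = "inv_into (carrier R) h"
  have g: "?g x \<in> carrier R" "h (?g x) = x" if "x \<in> carrier S" for x
    using bij that by (auto simp: bij_betw_def inv_into_into f_inv_into_f)
  have gh: "?g (h x) = x" if "x \<in> carrier R" for x
    using bij that by (simp add: bij_betw_def)
  have "?g \<in> ring_hom S R"
  proof (rule ring_hom_memI)
    show "?g (x \<otimes>\<^bsub>S\<^esub> y) = ?g x \<otimes>\<^bsub>R\<^esub> ?g y" if "x \<in> carrier S" "y \<in> carrier S" for x y
      using gh[OF m[OF g(1)[OF that(1)] g(1)[OF that(2)]]] that g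
      by (simp add: ring_hom_mult[OF hom])
    show "?g (x \<oplus>\<^bsub>S\<^esub> y) = ?g x \<oplus>\<^bsub>R\<^esub> ?g y" if "x \<in> carrier S" "y \<in> carrier S" for x y
      using gh[OF a[OF g(1)[OF that(1)] g(1)[OF that(2)]]] that g
      by (simp add: ring_hom_add[OF hom])
    show "?g \<one>\<^bsub>S\<^esub> = \<one>\<^bsub>R\<^esub>"
      using gh[OF o] by (simp add: ring_hom_one[OF hom])
  qed (rule g(1))
  then show ?thesis
    using bij by (simp add: ring_iso_def bij_betw_inv_into)
qed

context finite_graph
begin

subsection \<open>Cones of the cographic fan\<close>

lemma homology_arev: "c \<in> homology G arev \<Longrightarrow> e \<in> arcs G \<Longrightarrow> c (arev e) = - c e"
  by (simp add: homology_def edge_chains_def)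

lemma homology_outside: "c \<in> homology G arev \<Longrightarrow> e \<notin> arcs G \<Longrightarrow> c e = 0"
  by (simp add: homology_def edge_chains_def)

lemma homology_lincomb:
  assumes "u \<in> homology G arev" "v \<in> homology G arev"
  shows "(\<lambda>e. a * u e + b * v e) \<in> homology G arev"
proof -
  have "boundary G (\<lambda>e. a * u e + b * v e) = (\<lambda>x. a * boundary G u x + b * boundary G v x)"
    by (simp add: boundary_def sum.distrib sum_distrib_left)
  then show ?thesis
    using assms by (auto simp: homology_def edge_chains_def)
qed

lemma homology_zero: "(\<lambda>_. 0) \<in> homology G arev"
  by (simp add: homology_def edge_chains_def boundary_def)

lemma homology_add:
  "u \<in> homology G arev \<Longrightarrow> v \<in> homology G arev \<Longrightarrow> (\<lambda>e. u e + v e) \<in> homology G arev"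
  using homology_lincomb[of u v 1 1] by simp

lemma homology_of_int:
  assumes "c \<in> homology G arev"
  shows "(\<lambda>e. of_int (c e)) \<in> homology G arev"
proof -
  have "boundary G (\<lambda>e. of_int (c e)) = (\<lambda>v. of_int (boundary G c v))"
    by (simp add: boundary_def)
  then show ?thesis
    using assms by (auto simp: homology_def edge_chains_def)
qed

text \<open>Pairing with \<open>arc_chain arev e\<close> evaluates a chain at \<open>e\<close>, so
  the arrangement consists of coordinate hyperplanes inside the homology. The existence condition
  excludes the arcs on which every cycle vanishes (the bridges).\<close>

lemma arrangement_complement_iff:
  "v \<in> homology G arev - \<Union> (cographic_arrangement G arev) \<longleftrightarrow>
    v \<in> homology G arev \<and> (\<forall>e\<in>arcs G. (\<exists>u\<in>homology G arev. u e \<noteq> (0::real)) \<longrightarrow> v e \<noteq> 0)"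
proof -
  have form: "chain_form G u (arc_chain arev e) = u e" if "u \<in> homology G arev" "e \<in> arcs G" for u e
    using that by (simp add: chain_form_arc_chain homology_def)
  have hyp: "{v \<in> homology G arev. chain_form G v (arc_chain arev e) = 0} =
      {v \<in> homology G arev. v e = 0}" if "e \<in> arcs G" for e
    using that by (auto simp: form)
  have "cographic_arrangement G arev = (\<lambda>e. {v \<in> homology G arev. v e = 0}) `
      {e \<in> arcs G. \<exists>u\<in>homology G arev. u e \<noteq> (0::real)}"
    unfolding cographic_arrangement_def image_Collect
    by (intro Collect_cong ex_cong1) (auto simp: form hyp)
  then show ?thesis by auto
qed

text \<open>A coordinate is continuous and, off the bridges, has no zero on a connected component of
  the complement, so its sign is constant there; in the closure the sign survives weakly.\<close>

lemma chamber_same_sign: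
  assumes S: "S \<in> cographic_chambers G arev" and e: "e \<in> arcs G" and uv: "u \<in> S" "v \<in> S"
  shows "0 \<le> u e * v e"
proof -
  obtain C where C: "C \<in> components (homology G arev - \<Union> (cographic_arrangement G arev))"
    and S_eq: "S = closure C"
    using S by (auto simp: cographic_chambers_def)
  have inner: "0 \<le> u e * v e" if "u \<in> C" "v \<in> C" for u v
  proof (cases "\<exists>w\<in>homology G arev. w e \<noteq> (0::real)")
    case True
    have "connected ((\<lambda>w. w e) ` C)"
      by (intro connected_continuous_image continuous_on_product_coordinates
          in_components_connected[OF C] continuous_on_subset[OF _ subset_UNIV])
    note interval = connectedD_interval[OF this imageI imageI, of _ _ 0]
    have "w e \<noteq> 0" if "w \<in> C" for w
    proof -
      have "w \<in> homology G arev - \<Union> (cographic_arrangement G arev)"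
        using in_components_subset[OF C] that by blast
      then show ?thesis
        unfolding arrangement_complement_iff using True e by blast
    qed
    then have "0 \<notin> (\<lambda>w. w e) ` C"
      by auto
    then have "\<not> (u e < 0 \<and> 0 < v e)" "\<not> (v e < 0 \<and> 0 < u e)"
      using interval[OF that] interval[OF that(2,1)] by auto
    then show ?thesis
      by (metis linorder_not_less mult_nonneg_nonneg mult_nonpos_nonpos mult_zero_left
          mult_zero_right order_le_less)
  next
    \<comment> \<open>On a bridge both values are zero.\<close>
    case False
    moreover have "u \<in> homology G arev"
      using that(1) in_components_subset[OF C] by blast
    ultimately have "u e = 0" by blast
    then show ?thesis by simp
  qed
  have closed: "closed {w. 0 \<le> w e * r}" for r :: real
    by (rule closed_Collect_le[OF continuous_on_const])
      (rule continuous_on_mult_right[OF continuous_on_product_coordinates])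
  \<comment> \<open>The inequality passes to the closure in one argument at a time: here for
    \<open>u\<close>, with the other point still in \<open>C\<close>, and then for
    \<open>v\<close>.\<close>
  have half: "0 \<le> u e * w e" if "w \<in> C" for w
  proof -
    have "closure C \<subseteq> {x. 0 \<le> x e * w e}"
      by (rule closure_minimal[OF _ closed]) (use inner that in auto)
    then show ?thesis using uv(1) S_eq by auto
  qed
  have "closure C \<subseteq> {x. 0 \<le> x e * u e}"
    by (rule closure_minimal[OF _ closed]) (use half in \<open>auto simp: mult.commute\<close>)
  then have "0 \<le> v e * u e"
    using uv(2) S_eq by auto
  then show ?thesis
    by (simp only: mult.commute)
qed

text \<open>A real vector space is not a finite union of proper subspaces. The induction adds, for
  each new arc, a generic multiple of a cycle that is nonzero there.\<close>

lemma generic_cycle_exists: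
  "\<exists>g\<in>homology G arev. \<forall>e\<in>arcs G. (\<exists>u\<in>homology G arev. u e \<noteq> (0::real)) \<longrightarrow> g e \<noteq> (0::real)"
proof -
  have "\<exists>g\<in>homology G arev. \<forall>e\<in>F. (\<exists>u\<in>homology G arev. u e \<noteq> (0::real)) \<longrightarrow> g e \<noteq> (0::real)"
    if "finite F" for F
    using that
  proof (induction F)
    case empty
    then show ?case using homology_zero by auto
  next
    case (insert e F)
    then obtain g :: "'e \<Rightarrow> real" where g: "g \<in> homology G arev"
      "\<forall>e\<in>F. (\<exists>u\<in>homology G arev. u e \<noteq> (0::real)) \<longrightarrow> g e \<noteq> (0::real)" by blast
    show ?case
    proof (cases "\<exists>u\<in>homology G arev. u e \<noteq> (0::real)")
      case True
      then obtain u :: "'e \<Rightarrow> real" where u: "u \<in> homology G arev" "u e \<noteq> 0" by blast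
      \<comment> \<open>Each excluded quotient is the one multiple for which the combination would
        vanish at an arc \<open>f\<close> with \<open>u f\<close> nonzero; where \<open>u f\<close>
        is zero, the value of \<open>g\<close> is kept.\<close>
      obtain s where s: "s \<notin> insert 0 ((\<lambda>f. - g f / u f) ` insert e F)"
        using ex_new_if_finite[OF infinite_UNIV_char_0] insert.hyps(1)
        by (metis finite.insertI finite_imageI)
      have "1 * g f + s * u f \<noteq> 0" if f: "f \<in> insert e F" "\<exists>u\<in>homology G arev. u f \<noteq> (0::real)" for f
      proof (cases "u f = 0")
        case True
        then show ?thesis using f g(2) u(2) by auto
      next
        case False
        have "s \<noteq> - g f / u f" using s f(1) by blast
        with False show ?thesis by (simp add: field_simps eq_neg_iff_add_eq_0 add.commute)
      qed
      then show ?thesis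
        using homology_lincomb[OF g(1) u(1), of 1 s] by (intro bexI[of _ "\<lambda>e. 1 * g e + s * u e"]) auto
    next
      case False
      then show ?thesis using g by auto
    qed
  qed
  then show ?thesis using finite_arcs by blast
qed

text \<open>A cone of the fan lies in the closure of one chamber, where signs are compatible.
  Conversely, a chamber next to \<open>c + d\<close> is found by perturbing a large multiple of this
  sum by a generic cycle, and both \<open>c\<close> and \<open>d\<close> are limits of its
  points.\<close>

lemma common_cone_iff:
  assumes c: "c \<in> homology G arev" and d: "d \<in> homology G arev"
  shows "common_cone G arev c d \<longleftrightarrow> (\<forall>e\<in>arcs G. 0 \<le> c e * d e)"
proof
  assume "common_cone G arev c d"
  then obtain S where S: "S \<in> cographic_chambers G arev"
    "(\<lambda>e. real_of_int (c e)) \<in> S" "(\<lambda>e. real_of_int (d e)) \<in> S"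
    by (auto simp: common_cone_def cographic_fan_def cone_face_def)
  have "0 \<le> real_of_int (c e * d e)" if "e \<in> arcs G" for e
    using chamber_same_sign[OF S(1) that S(2,3)] by simp
  then show "\<forall>e\<in>arcs G. 0 \<le> c e * d e"
    by (simp only: of_int_0_le_iff) simp
next
  assume sign: "\<forall>e\<in>arcs G. 0 \<le> c e * d e"
  let ?U = "homology G arev - \<Union> (cographic_arrangement G arev)"
  obtain g :: "'e \<Rightarrow> real" where g: "g \<in> homology G arev"
    "\<And>e. e \<in> arcs G \<Longrightarrow> (\<exists>u\<in>homology G arev. u e \<noteq> (0::real)) \<Longrightarrow> g e \<noteq> 0"
    using generic_cycle_exists by blast
  \<comment> \<open>The sum bounds every \<open>\<bar>g e\<bar>\<close>; the added 1 makes the bound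
    strict.\<close>
  define M where "M = 1 + (\<Sum>e\<in>arcs G. \<bar>g e\<bar>)"
  have M: "\<bar>g e\<bar> < M" if "e \<in> arcs G" for e
    using member_le_sum[OF that, of "\<lambda>e. \<bar>g e\<bar>"] finite_arcs by (simp add: M_def)
  define x where "x = (\<lambda>e. M * real_of_int (c e + d e) + 1 * g e)"
  have x_hom: "x \<in> homology G arev"
    unfolding x_def using homology_lincomb[OF homology_of_int[OF homology_add[OF c d]] g(1)] .
  text \<open>The values of \<open>c + d\<close> are integers, so \<open>M\<close> makes \<open>x\<close> take their signs where they are nonzero.\<close>
  have x_pos: "x e > 0" if "e \<in> arcs G" "c e + d e > 0" for e
  proof -
    have "M * 1 \<le> M * real_of_int (c e + d e)"
      using that M[OF that(1)] by (intro mult_left_mono) auto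
    then show ?thesis using M[OF that(1)] by (simp add: x_def)
  qed
  have x_neg: "x e < 0" if "e \<in> arcs G" "c e + d e < 0" for e
  proof -
    have "M * real_of_int (c e + d e) \<le> M * (- 1)"
      using that M[OF that(1)] by (intro mult_left_mono) auto
    then show ?thesis using M[OF that(1)] by (simp add: x_def)
  qed
  have x_ne: "x e \<noteq> 0" if "e \<in> arcs G" "\<exists>u\<in>homology G arev. u e \<noteq> (0::real)" for e
  proof (cases "c e + d e" "0::int" rule: linorder_cases)
    \<comment> \<open>Where \<open>c + d\<close> vanishes, only the generic perturbation is
      left.\<close>
    case equal
    then have "x e = g e" by (simp add: x_def flip: of_int_add)
    then show ?thesis using g(2)[OF that] by simp
  qed (use x_pos x_neg that in force)+
  have x_U: "x \<in> ?U"
    unfolding arrangement_complement_iff using x_hom x_ne by blast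
  define C where "C = connected_component_set ?U x"
  have C: "C \<in> components ?U"
    unfolding C_def components_def using x_U by blast
  \<comment> \<open>If the nonzero values of \<open>b\<close> have the signs of
    \<open>c + d\<close>, hence those of \<open>x\<close>, then the segment from \<open>x\<close> to
    \<open>b\<close> crosses no hyperplane before its end.\<close>
  have approach: "(\<lambda>e. real_of_int (b e)) \<in> closure C"
    if b: "b \<in> homology G arev"
      and pos: "\<And>e. e \<in> arcs G \<Longrightarrow> b e > 0 \<Longrightarrow> c e + d e > 0"
      and neg: "\<And>e. e \<in> arcs G \<Longrightarrow> b e < 0 \<Longrightarrow> c e + d e < 0" for b
  proof -
    define \<gamma> where "\<gamma> = (\<lambda>t e. (1 - t) * x e + t * real_of_int (b e))"
    have cont: "continuous_on A \<gamma>" for A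
      unfolding \<gamma>_def by (intro continuous_on_coordinatewise_then_product continuous_intros)
    \<comment> \<open>The interval is half-open because the endpoint \<open>b\<close> may lie on
      hyperplanes.\<close>
    have in_U: "\<gamma> t \<in> ?U" if t: "t \<in> {0..<1}" for t
    proof -
      have "\<gamma> t e \<noteq> 0" if e: "e \<in> arcs G" "\<exists>u\<in>homology G arev. u e \<noteq> (0::real)" for e
      proof (cases "b e" "0::int" rule: linorder_cases)
        case equal
        then show ?thesis using x_ne[OF e] t by (simp add: \<gamma>_def)
      next
        case greater
        then have "(1 - t) * x e > 0" "t * real_of_int (b e) \<ge> 0"
          using x_pos[OF e(1) pos[OF e(1)]] t by auto
        then show ?thesis by (simp add: \<gamma>_def)
      next
        case less
        then have "(1 - t) * x e < 0" "t * real_of_int (b e) \<le> 0"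
          using x_neg[OF e(1) neg[OF e(1)]] t by (auto simp: mult_pos_neg mult_nonneg_nonpos)
        then show ?thesis by (simp add: \<gamma>_def)
      qed
      moreover have "\<gamma> t \<in> homology G arev"
        unfolding \<gamma>_def by (rule homology_lincomb[OF x_hom homology_of_int[OF b]])
      ultimately show ?thesis
        unfolding arrangement_complement_iff by blast
    qed
    have "\<gamma> ` {0..<1} \<subseteq> C"
      unfolding C_def
    proof (rule connected_component_maximal)
      show "x \<in> \<gamma> ` {0..<1}"
        by (rule image_eqI[of _ _ 0]) (simp_all add: \<gamma>_def)
      show "connected (\<gamma> ` {0..<1})"
        by (intro connected_continuous_image cont connected_Ico)
    qed (use in_U in blast)
    then have "\<gamma> ` closure {0..<1} \<subseteq> closure C"
      using closure_subset by (intro image_closure_subset cont) auto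
    moreover have "\<gamma> 1 = (\<lambda>e. real_of_int (b e))"
      by (simp add: \<gamma>_def)
    ultimately show ?thesis
      using imageI[of 1 "closure {0..<1::real}" \<gamma>] by auto
  qed
  \<comment> \<open>The zero functional exhibits the closure of the chamber as a face of
    itself.\<close>
  have S: "closure C \<in> cographic_fan G arev"
    unfolding cographic_fan_def cographic_chambers_def cone_face_def linear_functional_on_def
    using C by (auto intro!: bexI[of _ C] exI[of _ "\<lambda>_. 0"])
  \<comment> \<open>Compatible signs exclude cancellation, so \<open>c + d\<close> inherits every
    strict sign of \<open>c\<close> and of \<open>d\<close>.\<close>
  have "(0 < a \<longrightarrow> 0 < a + b) \<and> (a < 0 \<longrightarrow> a + b < 0) \<and> (0 < b \<longrightarrow> 0 < a + b) \<and> (b < 0 \<longrightarrow> a + b < 0)"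
    if "0 \<le> a * b" for a b :: int
    using that by (auto simp: zero_le_mult_iff)
  note same = this[OF bspec[OF sign]]
  have "(\<lambda>e. real_of_int (c e)) \<in> closure C" "(\<lambda>e. real_of_int (d e)) \<in> closure C"
    by (rule approach; use c d same in blast)+
  with S show "common_cone G arev c d"
    unfolding common_cone_def by blast
qed

subsection \<open>Monomials of chains\<close>

definition chain_monom :: "('e \<Rightarrow> int) \<Rightarrow> 'e \<Rightarrow>\<^sub>0 nat" where
  "chain_monom c = (\<Sum>e\<in>arcs G. Poly_Mapping.single e (nat (c e)))"

text \<open>The candidate inverse of \<open>chain_monom\<close>. Off the arcs, where
  \<open>arev\<close> is the identity, the two terms cancel.\<close>

definition monom_chain :: "('e \<Rightarrow>\<^sub>0 nat) \<Rightarrow> 'e \<Rightarrow> int" where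
  "monom_chain m = (\<lambda>e. int (Poly_Mapping.lookup m e) - int (Poly_Mapping.lookup m (arev e)))"

lemma lookup_chain_monom:
  "c \<in> homology G arev \<Longrightarrow> Poly_Mapping.lookup (chain_monom c) e = nat (c e)"
  by (auto simp: chain_monom_def lookup_sum lookup_single when_def homology_outside)

lemma chain_monom_zero: "chain_monom (\<lambda>_. 0) = 0"
  by (simp add: chain_monom_def)

lemma keys_chain_monom: "c \<in> homology G arev \<Longrightarrow> Poly_Mapping.keys (chain_monom c) \<subseteq> arcs G"
  using homology_outside[of c] by (fastforce simp: in_keys_iff lookup_chain_monom)

lemma chain_monom_not_vanishing: "c \<in> homology G arev \<Longrightarrow> \<not> vanishing (chain_monom c)"
  by (auto simp: vanishing_def lookup_chain_monom homology_arev)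

lemma monom_chain_chain_monom:
  assumes c: "c \<in> homology G arev"
  shows "monom_chain (chain_monom c) = c"
proof
  fix e show "monom_chain (chain_monom c) e = c e"
    using homology_arev[OF c, of e] homology_outside[OF c, of e] arev_eq[of e]
    by (cases "e \<in> arcs G") (simp_all add: monom_chain_def lookup_chain_monom[OF c])
qed

lemma inj_on_chain_monom: "inj_on chain_monom (homology G arev)"
  by (rule inj_on_inverseI[OF monom_chain_chain_monom])

text \<open>Reversal exchanges the arcs ending at \<open>v\<close> with those starting at
  \<open>v\<close>. This turns \<open>boundary\<close>, which sums over incoming arcs, into a
  comparison of incoming and outgoing exponents.\<close>

lemma sum_arev_tail:
  "(\<Sum>e | e \<in> arcs G \<and> head G e = v. f (arev e)) = (\<Sum>e | e \<in> arcs G \<and> tail G e = v. f e)"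
  by (rule sum.reindex_bij_witness[of _ arev arev]) auto

text \<open>This is weight zero for the torus: the character of the monomial involves the parameter
  at \<open>v\<close> with exponent the outgoing minus the incoming total.\<close>

definition balanced :: "('e \<Rightarrow>\<^sub>0 nat) \<Rightarrow> bool" where
  "balanced m \<longleftrightarrow> (\<forall>v. (\<Sum>e | e \<in> arcs G \<and> tail G e = v. Poly_Mapping.lookup m e) =
    (\<Sum>e | e \<in> arcs G \<and> head G e = v. Poly_Mapping.lookup m e))"

lemma boundary_monom_chain:
  "boundary G (monom_chain m) v = int (\<Sum>e | e \<in> arcs G \<and> head G e = v. Poly_Mapping.lookup m e) -
    int (\<Sum>e | e \<in> arcs G \<and> tail G e = v. Poly_Mapping.lookup m e)"
  by (simp add: boundary_def monom_chain_def sum_subtractf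
      sum_arev_tail[of "\<lambda>e. int (Poly_Mapping.lookup m e)"])

lemma monom_chain_in_homology_iff:
  assumes "Poly_Mapping.keys m \<subseteq> arcs G"
  shows "monom_chain m \<in> homology G arev \<longleftrightarrow> balanced m"
proof -
  have "monom_chain m \<in> edge_chains G arev"
    using assms by (auto simp: edge_chains_def monom_chain_def arev_eq)
  then show ?thesis
    unfolding homology_def balanced_def
    by (simp add: fun_eq_iff boundary_monom_chain del: of_nat_sum) metis
qed

lemma chain_monom_balanced: "c \<in> homology G arev \<Longrightarrow> balanced (chain_monom c)"
  using monom_chain_in_homology_iff[OF keys_chain_monom] monom_chain_chain_monom by simp

text \<open>At most one orientation of each edge occurs in \<open>m\<close>, so the positive part of
  the difference of the two exponents recovers the exponent itself.\<close>

lemma chain_monom_monom_chain: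
  assumes "Poly_Mapping.keys m \<subseteq> arcs G" "balanced m" "\<not> vanishing m"
  shows "chain_monom (monom_chain m) = m"
proof (rule poly_mapping_eqI)
  fix e
  have hom: "monom_chain m \<in> homology G arev"
    using assms monom_chain_in_homology_iff by blast
  show "Poly_Mapping.lookup (chain_monom (monom_chain m)) e = Poly_Mapping.lookup m e"
  proof (cases "e \<in> arcs G")
    case True
    then show ?thesis
      using assms(3) unfolding lookup_chain_monom[OF hom]
      by (auto simp: monom_chain_def vanishing_def)
  next
    case False
    then show ?thesis
      using assms(1) unfolding lookup_chain_monom[OF hom]
      by (auto simp: monom_chain_def arev_eq in_keys_iff)
  qed
qed

text \<open>Taking positive parts is additive on integers of compatible sign.\<close>

lemma chain_monom_add:
  assumes c: "c \<in> homology G arev" and d: "d \<in> homology G arev" and "common_cone G arev c d"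
  shows "chain_monom (\<lambda>e. c e + d e) = chain_monom c + chain_monom d"
proof (rule poly_mapping_eqI)
  fix e
  have "0 \<le> c e * d e"
    using assms common_cone_iff[OF c d] by (cases "e \<in> arcs G") (auto simp: homology_outside)
  then have "nat (c e + d e) = nat (c e) + nat (d e)"
    by (auto simp: zero_le_mult_iff nat_add_distrib)
  then show "Poly_Mapping.lookup (chain_monom (\<lambda>e. c e + d e)) e =
      Poly_Mapping.lookup (chain_monom c + chain_monom d) e"
    using c d by (simp add: lookup_add lookup_chain_monom homology_add)
qed

text \<open>At an edge with opposite signs, one factor contributes the variable of the arc and the
  other that of its reverse.\<close>

lemma vanishing_chain_monom_add:
  assumes c: "c \<in> homology G arev" and d: "d \<in> homology G arev" and "\<not> common_cone G arev c d"
  shows "vanishing (chain_monom c + chain_monom d)"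
proof -
  obtain e where e: "e \<in> arcs G" "c e * d e < 0"
    using assms common_cone_iff[OF c d] by force
  then have "(c e > 0 \<and> d e < 0) \<or> (c e < 0 \<and> d e > 0)"
    by (auto simp: mult_less_0_iff)
  then show ?thesis
    unfolding vanishing_def using e c d
    by (intro bexI[of _ e]) (auto simp: lookup_add lookup_chain_monom homology_arev)
qed

subsection \<open>Invariants of the torus\<close>

lemma edge_coset_hom:
  "edge_coset G arev \<in> ring_hom (edge_poly_ring G) (edge_algebra G arev)"
  using ideal.rcos_ring_hom[OF edge_ideal_ideal]
  unfolding edge_algebra_def edge_coset_def[abs_def] .

lemma edge_algebra_carrierE:
  assumes "X \<in> carrier (edge_algebra G arev)"
  obtains p where "p \<in> carrier (edge_poly_ring G)" "X = edge_coset G arev p"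
  using assms by (auto simp: edge_algebra_def FactRing_def A_RCOSETS_def' a_r_coset_def' edge_coset_def)

text \<open>The torus scales each monomial by its character, and a coset remembers exactly the
  coefficients at the monomials that are not \<open>vanishing\<close>; invariance can therefore be
  tested on one monomial at a time.\<close>

lemma edge_coset_in_torus_invariants_iff:
  fixes p :: "('e \<Rightarrow>\<^sub>0 nat) \<Rightarrow>\<^sub>0 'k::field"
  assumes p: "p \<in> carrier (edge_poly_ring G)"
  shows "edge_coset G arev p \<in> torus_invariants G arev \<longleftrightarrow>
    (\<forall>m\<in>Poly_Mapping.keys p. \<not> vanishing m \<longrightarrow> balanced m)"
proof
  assume inv: "edge_coset G arev p \<in> torus_invariants G arev"
  \<comment> \<open>The universal point: \<open>?l v\<close> is the Laurent variable of
    \<open>v\<close> and \<open>?l' v\<close> its inverse, so that the character of \<open>m\<close>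
    becomes the Laurent monomial with exponent the weight of \<open>m\<close>.\<close>
  let ?l = "\<lambda>v. Poly_Mapping.single (Poly_Mapping.single v (1::int)) (1::'k)"
  let ?l' = "\<lambda>v. Poly_Mapping.single (Poly_Mapping.single v (-1::int)) (1::'k)"
  have point: "torus_point G ?l ?l'"
    by (auto simp: torus_point_def mult_single simp flip: single_add)
  have hom: "unital_ring_hom (Poly_Mapping.single (0 :: 'v \<Rightarrow>\<^sub>0 int) :: 'k \<Rightarrow> _)"
    by (auto simp: unital_ring_hom_def single_add mult_single)
  show "\<forall>m\<in>Poly_Mapping.keys p. \<not> vanishing m \<longrightarrow> balanced m"
  proof (intro ballI impI)
    fix m assume m: "m \<in> Poly_Mapping.keys p" "\<not> vanishing m"
    then have km: "Poly_Mapping.keys m \<subseteq> arcs G" and nz: "Poly_Mapping.lookup p m \<noteq> 0"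
      using p by (auto simp: edge_poly_ring_def in_keys_iff)
    define w where "w = (\<Sum>e\<in>Poly_Mapping.keys m.
      Poly_Mapping.single (tail G e) (int (Poly_Mapping.lookup m e)) -
      Poly_Mapping.single (head G e) (int (Poly_Mapping.lookup m e)))"
    have "Poly_Mapping.single 0 (Poly_Mapping.lookup p m) * torus_char ?l ?l' m =
        Poly_Mapping.single 0 (Poly_Mapping.lookup p m)"
      using inv m(2) hom point
      unfolding torus_invariants_def mem_Collect_eq torus_fixed_over_iff[OF p] by blast
    then have "Poly_Mapping.single w (Poly_Mapping.lookup p m) =
        Poly_Mapping.single 0 (Poly_Mapping.lookup p m)"
      unfolding torus_char_universal w_def by (simp add: mult_single)
    \<comment> \<open>A nonzero coefficient determines the exponent at which it stands.\<close>
    then have "w = 0"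
      using nz by (metis lookup_single_eq lookup_single_not_eq)
    have "boundary G (monom_chain m) v = 0" for v
    proof -
      have "0 = Poly_Mapping.lookup w v"
        using \<open>w = 0\<close> by simp
      also have "\<dots> = (\<Sum>e\<in>Poly_Mapping.keys m.
          (if tail G e = v then int (Poly_Mapping.lookup m e) else 0) -
          (if head G e = v then int (Poly_Mapping.lookup m e) else 0))"
        by (simp add: w_def lookup_sum lookup_minus lookup_single when_def)
      also have "\<dots> = (\<Sum>e\<in>arcs G.
          (if tail G e = v then int (Poly_Mapping.lookup m e) else 0) -
          (if head G e = v then int (Poly_Mapping.lookup m e) else 0))"
        by (rule sum.mono_neutral_left) (use km in \<open>auto simp: in_keys_iff\<close>)
      \<comment> \<open>The weight counts tails positively and heads negatively, opposite to the
        boundary.\<close>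
      also have "\<dots> = - boundary G (monom_chain m) v"
        by (simp add: boundary_monom_chain sum_subtractf sum.inter_filter[symmetric])
      finally show ?thesis by simp
    qed
    then show "balanced m"
      by (simp add: boundary_monom_chain balanced_def flip: of_nat_sum)
  qed
next
  assume bal: "\<forall>m\<in>Poly_Mapping.keys p. \<not> vanishing m \<longrightarrow> balanced m"
  have char1: "torus_char l l' m = 1"
    if "torus_point G l l'" "\<not> vanishing m" "m \<in> Poly_Mapping.keys p"
    for l l' :: "'v \<Rightarrow> ('v \<Rightarrow>\<^sub>0 int) \<Rightarrow>\<^sub>0 'k" and m
    using that bal p by (intro torus_char_eq_1) (auto simp: edge_poly_ring_def balanced_def)
  have "\<phi> (Poly_Mapping.lookup p m) * torus_char l l' m = \<phi> (Poly_Mapping.lookup p m)"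
    if \<phi>: "unital_ring_hom \<phi>" and l: "torus_point G l l'" and m: "\<not> vanishing m"
    for \<phi> :: "'k \<Rightarrow> ('v \<Rightarrow>\<^sub>0 int) \<Rightarrow>\<^sub>0 'k" and l l' m
  proof (cases "m \<in> Poly_Mapping.keys p")
    case False
    have "\<phi> 0 = 0"
      using \<phi> unfolding unital_ring_hom_def by (metis add_cancel_right_right)
    with False show ?thesis by (simp add: in_keys_iff)
  qed (use char1[OF l m] in simp)
  moreover have "edge_coset G arev p \<in> carrier (edge_algebra G arev)"
    by (rule ring_hom_closed[OF edge_coset_hom p])
  ultimately show "edge_coset G arev p \<in> torus_invariants G arev"
    unfolding torus_invariants_def mem_Collect_eq torus_fixed_over_iff[OF p] by blast
qed

subsection \<open>The isomorphism\<close>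

text \<open>The linear extension of \<open>chain_monom\<close> from basis elements to the ring; it
  is compatible with products modulo \<open>edge_ideal\<close>.\<close>

definition cycle_poly :: "(('e \<Rightarrow> int) \<Rightarrow>\<^sub>0 'k::field) \<Rightarrow> (('e \<Rightarrow>\<^sub>0 nat) \<Rightarrow>\<^sub>0 'k)" where
  "cycle_poly q = (\<Sum>c\<in>Poly_Mapping.keys q.
    Poly_Mapping.single (chain_monom c) (Poly_Mapping.lookup q c))"

text \<open>Provides a common index set for both summands and their sum, whose support may shrink by
  cancellation.\<close>

lemma cycle_poly_superset:
  assumes "finite A" "Poly_Mapping.keys q \<subseteq> A"
  shows "cycle_poly q = (\<Sum>c\<in>A. Poly_Mapping.single (chain_monom c) (Poly_Mapping.lookup q c))"
  unfolding cycle_poly_def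
  by (rule sum.mono_neutral_left) (use assms in \<open>auto simp: in_keys_iff\<close>)

lemma cycle_poly_add: "cycle_poly (p + q) = cycle_poly p + cycle_poly q"
proof -
  let ?A = "Poly_Mapping.keys p \<union> Poly_Mapping.keys q"
  have "Poly_Mapping.keys (p + q) \<subseteq> ?A"
    by (rule keys_add)
  then show ?thesis
    by (simp add: cycle_poly_superset[of ?A] lookup_add single_add sum.distrib)
qed

lemma cycle_poly_single: "cycle_poly (Poly_Mapping.single c a) = Poly_Mapping.single (chain_monom c) a"
  by (simp add: cycle_poly_def)

lemma cycle_poly_zero: "cycle_poly 0 = 0"
  by (simp add: cycle_poly_def)

lemma cycle_poly_sum: "cycle_poly (\<Sum>i\<in>I. f i) = (\<Sum>i\<in>I. cycle_poly (f i))"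
  by (induction I rule: infinite_finite_induct) (simp_all add: cycle_poly_add cycle_poly_zero)

lemma keys_cycle_poly: "Poly_Mapping.keys (cycle_poly q) \<subseteq> chain_monom ` Poly_Mapping.keys q"
  unfolding cycle_poly_def
  by (rule order_trans[OF Poly_Mapping.keys_sum]) (auto split: if_splits)

text \<open>Since \<open>chain_monom\<close> is injective on cycles, no two terms of the sum meet in
  the same monomial.\<close>

lemma lookup_cycle_poly:
  assumes q: "Poly_Mapping.keys q \<subseteq> homology G arev" and c: "c \<in> homology G arev"
  shows "Poly_Mapping.lookup (cycle_poly q) (chain_monom c) = Poly_Mapping.lookup q c"
proof -
  have "Poly_Mapping.lookup (cycle_poly q) (chain_monom c) =
      (\<Sum>d\<in>Poly_Mapping.keys q. if d = c then Poly_Mapping.lookup q d else 0)"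
    unfolding cycle_poly_def lookup_sum lookup_single when_def
    by (rule sum.cong) (use q c inj_on_eq_iff[OF inj_on_chain_monom] in auto)
  then show ?thesis
    by (simp add: sum.delta in_keys_iff)
qed

lemma cycle_poly_carrier:
  "Poly_Mapping.keys q \<subseteq> homology G arev \<Longrightarrow> cycle_poly q \<in> carrier (edge_poly_ring G)"
  using keys_cycle_poly keys_chain_monom by (fastforce simp: edge_poly_ring_def)

lemma cographic_ring_simps:
  "carrier (cographic_ring G arev) = {p. Poly_Mapping.keys p \<subseteq> homology G arev}"
  "p \<otimes>\<^bsub>cographic_ring G arev\<^esub> q =
    (\<Sum>c\<in>Poly_Mapping.keys p. \<Sum>d\<in>Poly_Mapping.keys q.
      if common_cone G arev c d
      then Poly_Mapping.single (\<lambda>e. c e + d e) (Poly_Mapping.lookup p c * Poly_Mapping.lookup q d)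
      else 0)"
  "\<one>\<^bsub>cographic_ring G arev\<^esub> = Poly_Mapping.single (\<lambda>_. 0) 1"
  "p \<oplus>\<^bsub>cographic_ring G arev\<^esub> q = p + q"
  by (simp_all add: cographic_ring_def)

lemma cographic_mult_closed:
  assumes "p \<in> carrier (cographic_ring G arev)" "q \<in> carrier (cographic_ring G arev)"
  shows "p \<otimes>\<^bsub>cographic_ring G arev\<^esub> q \<in> carrier (cographic_ring G arev)"
proof -
  have sub: "Poly_Mapping.keys (\<Sum>i\<in>I. f i) \<subseteq> homology G arev"
    if "\<And>i. i \<in> I \<Longrightarrow> Poly_Mapping.keys (f i) \<subseteq> homology G arev" for I and f :: "'i \<Rightarrow> ('e \<Rightarrow> int) \<Rightarrow>\<^sub>0 'b::comm_monoid_add"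
    using Poly_Mapping.keys_sum[of f I] that by blast
  show ?thesis
    using assms unfolding cographic_ring_simps mem_Collect_eq
    by (intro sub) (auto intro: homology_add split: if_splits)
qed

text \<open>Both sides are compared pair by pair. For cycles in a common cone the monomials
  multiply; otherwise their product is \<open>vanishing\<close> and contributes nothing at
  \<open>m\<close>. By \<open>edge_coset_eq_iff\<close> this is equality in the quotient.\<close>

lemma cycle_poly_mult:
  assumes p: "p \<in> carrier (cographic_ring G arev)" and q: "q \<in> carrier (cographic_ring G arev)"
    and m: "\<not> vanishing m"
  shows "Poly_Mapping.lookup (cycle_poly (p \<otimes>\<^bsub>cographic_ring G arev\<^esub> q)) m =
    Poly_Mapping.lookup (cycle_poly p * cycle_poly q) m"
proof -
  have prod: "cycle_poly p * cycle_poly q = (\<Sum>c\<in>Poly_Mapping.keys p. \<Sum>d\<in>Poly_Mapping.keys q.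
      Poly_Mapping.single (chain_monom c + chain_monom d)
        (Poly_Mapping.lookup p c * Poly_Mapping.lookup q d))"
    by (simp add: cycle_poly_def sum_product mult_single)
  show ?thesis
    unfolding prod cographic_ring_simps cycle_poly_sum lookup_sum
  proof (intro sum.cong refl)
    fix c d assume "c \<in> Poly_Mapping.keys p" "d \<in> Poly_Mapping.keys q"
    then have "c \<in> homology G arev" "d \<in> homology G arev"
      using p q by (auto simp: cographic_ring_simps)
    note cd = chain_monom_add[OF this] vanishing_chain_monom_add[OF this]
    show "Poly_Mapping.lookup (cycle_poly (if common_cone G arev c d
          then Poly_Mapping.single (\<lambda>e. c e + d e) (Poly_Mapping.lookup p c * Poly_Mapping.lookup q d)
          else 0)) m =
        Poly_Mapping.lookup (Poly_Mapping.single (chain_monom c + chain_monom d)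
          (Poly_Mapping.lookup p c * Poly_Mapping.lookup q d)) m"
      using cd m by (auto simp: cycle_poly_single cycle_poly_zero lookup_single when_def)
  qed
qed

lemma cycle_coset_iso:
  "(\<lambda>q. edge_coset G arev (cycle_poly q))
    \<in> ring_iso (cographic_ring G arev :: (('e \<Rightarrow> int) \<Rightarrow>\<^sub>0 'k::field) ring) (invariant_ring G arev)"
proof -
  let ?R = "cographic_ring G arev :: (('e \<Rightarrow> int) \<Rightarrow>\<^sub>0 'k) ring"
  let ?P = "edge_poly_ring G :: (('e \<Rightarrow>\<^sub>0 nat) \<Rightarrow>\<^sub>0 'k) ring"
  let ?h = "\<lambda>q :: ('e \<Rightarrow> int) \<Rightarrow>\<^sub>0 'k. edge_coset G arev (cycle_poly q)"
  interpret P: cring ?P by (rule edge_poly_ring_cring)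
  have carr: "cycle_poly q \<in> carrier ?P" if "q \<in> carrier ?R" for q
    using that by (simp add: cographic_ring_simps cycle_poly_carrier)
  have ops: "x \<otimes>\<^bsub>?P\<^esub> y = x * y" "x \<oplus>\<^bsub>?P\<^esub> y = x + y" "\<one>\<^bsub>?P\<^esub> = 1" for x y
    by (simp_all add: edge_poly_ring_def)
  have inv_simps: "carrier (invariant_ring G arev) = torus_invariants G arev"
    "X \<otimes>\<^bsub>invariant_ring G arev\<^esub> Y = X \<otimes>\<^bsub>edge_algebra G arev\<^esub> Y"
    "X \<oplus>\<^bsub>invariant_ring G arev\<^esub> Y = X \<oplus>\<^bsub>edge_algebra G arev\<^esub> Y"
    "\<one>\<^bsub>invariant_ring G arev\<^esub> = \<one>\<^bsub>edge_algebra G arev\<^esub>"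
    for X Y :: "(('e \<Rightarrow>\<^sub>0 nat) \<Rightarrow>\<^sub>0 'k) set"
    by (simp_all add: invariant_ring_def)
  have hom: "edge_coset G arev \<in> ring_hom ?P (edge_algebra G arev)"
    by (rule edge_coset_hom)
  have into: "?h q \<in> torus_invariants G arev" if "q \<in> carrier ?R" for q
    using that keys_cycle_poly[of q] chain_monom_balanced
    unfolding edge_coset_in_torus_invariants_iff[OF carr[OF that]] cographic_ring_simps by blast
  have "?h \<in> ring_hom ?R (invariant_ring G arev)"
  proof (rule ring_hom_memI; unfold inv_simps)
    show "?h (x \<otimes>\<^bsub>?R\<^esub> y) = ?h x \<otimes>\<^bsub>edge_algebra G arev\<^esub> ?h y"
      if xy: "x \<in> carrier ?R" "y \<in> carrier ?R" for x y
    proof -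
      have "?h (x \<otimes>\<^bsub>?R\<^esub> y) = edge_coset G arev (cycle_poly x \<otimes>\<^bsub>?P\<^esub> cycle_poly y)"
        using cycle_poly_mult[OF xy]
        by (subst edge_coset_eq_iff) (auto simp: carr cographic_mult_closed xy P.m_closed, simp add: ops)
      then show ?thesis
        by (simp add: ring_hom_mult[OF hom] carr xy)
    qed
    show "?h (x \<oplus>\<^bsub>?R\<^esub> y) = ?h x \<oplus>\<^bsub>edge_algebra G arev\<^esub> ?h y"
      if "x \<in> carrier ?R" "y \<in> carrier ?R" for x y
      using ring_hom_add[OF hom carr[OF that(1)] carr[OF that(2)]]
      by (simp add: ops cographic_ring_simps cycle_poly_add)
    show "?h \<one>\<^bsub>?R\<^esub> = \<one>\<^bsub>edge_algebra G arev\<^esub>"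
      using ring_hom_one[OF hom]
      by (simp add: ops cographic_ring_simps cycle_poly_single chain_monom_zero)
  qed (rule into)
  \<comment> \<open>The coefficient at a cycle \<open>c\<close> can be read off from the coset,
    because \<open>chain_monom c\<close> is not \<open>vanishing\<close>.\<close>
  moreover have "inj_on ?h (carrier ?R)"
  proof (rule inj_onI)
    fix p q assume pq: "p \<in> carrier ?R" "q \<in> carrier ?R" "?h p = ?h q"
    then have keys: "Poly_Mapping.keys p \<subseteq> homology G arev" "Poly_Mapping.keys q \<subseteq> homology G arev"
      by (simp_all add: cographic_ring_simps)
    show "p = q"
    proof (rule poly_mapping_eqI)
      fix c show "Poly_Mapping.lookup p c = Poly_Mapping.lookup q c"
      proof (cases "c \<in> homology G arev")
        case True
        then show ?thesis
          using pq edge_coset_eq_iff[OF carr carr] chain_monom_not_vanishing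
          by (metis keys lookup_cycle_poly)
      next
        case False
        then show ?thesis using keys by (metis in_keys_iff subsetD)
      qed
    qed
  qed
  moreover have "X \<in> ?h ` carrier ?R" if X: "X \<in> torus_invariants G arev" for X
  proof -
    from X obtain p where p: "p \<in> carrier ?P" and Xp: "X = edge_coset G arev p"
      by (auto simp: torus_invariants_def elim: edge_algebra_carrierE)
    \<comment> \<open>Discarding the \<open>vanishing\<close> monomials does not change the coset,
      and by invariance the remaining ones are balanced, hence come from cycles.\<close>
    define N where "N = {m \<in> Poly_Mapping.keys p. \<not> vanishing m}"
    define q where "q = (\<Sum>m\<in>N. Poly_Mapping.single (monom_chain m) (Poly_Mapping.lookup p m))"
    have N: "Poly_Mapping.keys m \<subseteq> arcs G" "balanced m" "\<not> vanishing m" if "m \<in> N" for m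
      using that p X[unfolded Xp edge_coset_in_torus_invariants_iff[OF p]]
      by (auto simp: N_def edge_poly_ring_def)
    have "Poly_Mapping.keys q \<subseteq> monom_chain ` N"
      unfolding q_def by (rule order_trans[OF Poly_Mapping.keys_sum]) (auto split: if_splits)
    then have q: "q \<in> carrier ?R"
      using N monom_chain_in_homology_iff by (auto simp: cographic_ring_simps)
    have "cycle_poly q = (\<Sum>m\<in>N. Poly_Mapping.single m (Poly_Mapping.lookup p m))"
      unfolding q_def cycle_poly_sum cycle_poly_single
      by (rule sum.cong) (simp_all add: N chain_monom_monom_chain)
    then have "Poly_Mapping.lookup p m = Poly_Mapping.lookup (cycle_poly q) m" if "\<not> vanishing m" for m
      using that by (auto simp: lookup_sum lookup_single when_def sum.delta N_def in_keys_iff)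
    then have "X = ?h q"
      unfolding Xp edge_coset_eq_iff[OF p carr[OF q]] by blast
    with q show ?thesis by blast
  qed
  ultimately show ?thesis
    using into by (auto simp: ring_iso_def bij_betw_def inv_simps)
qed

end

theorem theorem1:
  fixes G :: "('v, 'e) pre_digraph" and arev :: "'e \<Rightarrow> 'e"
  assumes "finite_graph G arev"
  shows "k_algebra_iso
    (invariant_ring G arev :: (('e \<Rightarrow>\<^sub>0 nat) \<Rightarrow>\<^sub>0 'k::field) set ring) (edge_const G arev)
    (cographic_ring G arev :: (('e \<Rightarrow> int) \<Rightarrow>\<^sub>0 'k) ring) cographic_const"
proof -
  interpret finite_graph G arev by fact
  let ?R = "cographic_ring G arev :: (('e \<Rightarrow> int) \<Rightarrow>\<^sub>0 'k) ring"
  let ?h = "\<lambda>q :: ('e \<Rightarrow> int) \<Rightarrow>\<^sub>0 'k. edge_coset G arev (cycle_poly q)"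
  have "inv_into (carrier ?R) ?h \<in> ring_iso (invariant_ring G arev) ?R"
  proof (rule ring_iso_inv_into[OF cycle_coset_iso cographic_mult_closed])
    show "x \<oplus>\<^bsub>?R\<^esub> y \<in> carrier ?R" if "x \<in> carrier ?R" "y \<in> carrier ?R" for x y
      using that keys_add[of x y] by (auto simp: cographic_ring_simps)
    show "\<one>\<^bsub>?R\<^esub> \<in> carrier ?R"
      by (simp add: cographic_ring_simps homology_zero)
  qed
  \<comment> \<open>Compatibility with scalars is checked before inversion: the zero cycle has the
    monomial 1, so constants go to constants.\<close>
  moreover have "inv_into (carrier ?R) ?h (edge_const G arev a) = cographic_const a" for a
  proof (rule inv_into_f_eq)
    show "inj_on ?h (carrier ?R)"
      using cycle_coset_iso by (auto simp: ring_iso_def bij_betw_def)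
    show "cographic_const a \<in> carrier ?R"
      by (simp add: cographic_ring_simps cographic_const_def homology_zero)
    show "?h (cographic_const a) = edge_const G arev a"
      by (simp add: cographic_const_def edge_const_def cycle_poly_single chain_monom_zero)
  qed
  ultimately show ?thesis
    unfolding k_algebra_iso_def by blast
qed

end
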